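(* Let $F:[0,1]\times\mathbb R^2\to\mathbb R$, $(x,y,z)\mapsto F(x,y,z)$, be continuous, bounded and globally Lipschitz with respect to $(y,z)$. Then for any $A,B\in\mathbb R$ there exists a solution of the boundary value problem $$Lu(x)=F(x,u,u'),\qquad u(0)=A,\qquad u(1)=B .$$
   Context: Let $\sigma,\beta:\mathbb R\to\mathbb R$ be continuous with $\sigma>0$. $C^0$ denotes the continuous functions on $\mathbb R$ with the topology of uniform convergence on compacts; $C^k$ the $k$-times continuously differentiable functions on $\mathbb R$ with the topology of uniform convergence on compacts of the function and its first $k$ derivatives. Formally $Lg=\frac{\sigma^2}{2}g''+\beta'g'$. A mollifier is a Schwartz function $\Phi$ on $\mathbb R$ with $\int\Phi(x)\,dx=1$; put $\Phi_n(x)=n\Phi(nx)$, $\sigma_n^2=\sigma^2*\Phi_n$, $\beta_n=\beta*\Phi_n$ (these convolutions are understood to be well defined, as absolutely convergent integrals, for every mollifier) and $L_ng=\frac{\sigma_n^2}{2}g''+\beta_n'g'$. Standing assumption: $\Sigma(x)=\lim_{n\to\infty}2\int_0^x\frac{\beta_n'}{\sigma_n^2}(y)\,dy$ exists in $C^0$, independently of the mollifier. For $l\in C^0$, a function $f\in C^1$ is a $C^1$-solution of $Lf=l$ if for every mollifier $\Phi$ there are sequences $(f_n)$ in $C^2$ and $(l_n)$ in $C^0$ with $L_nf_n=l_n$, $f_n\to f$ in $C^1$, $l_n\to l$ in $C^0$. Boundary value problems: let $-\infty<a<b<\infty$, $A,B\in\mathbb R$. For continuous $g:[a,b]\to\mathbb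 R$, a function $u:[a,b]\to\mathbb R$ is a solution of $Lu=g$, $u(a)=A$, $u(b)=B$ if there are a continuous extension $\tilde g:\mathbb R\to\mathbb R$ of $g$ and $\tilde u\in C^1$ with $\tilde u|_{[a,b]}=u$ such that $\tilde u$ is a $C^1$-solution of $L\tilde u=\tilde g$ and $\tilde u(a)=A$, $\tilde u(b)=B$. For continuous $F:[a,b]\times\mathbb R^2\to\mathbb R$, a function $u\in C^1([a,b])$ is a solution of $Lu=F(x,u,u')$, $u(a)=A$, $u(b)=B$ if it is a solution, in the previous sense, of $Lu=\ell$, $u(a)=A$, $u(b)=B$ with $\ell(x)=F(x,u(x),u'(x))$. $F$ is globally Lipschitz with respect to $(y,z)$ if it is Lipschitz in $(y,z)$ with a constant independent of $x$. *)

theory Defs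
  imports "HOL-Analysis.Analysis"
begin

definition C_k :: "nat \<Rightarrow> (real \<Rightarrow> real) set" where
  "C_k k = {f. (\<forall>j<k. \<forall>x. (deriv ^^ j) f differentiable at x) \<and>
               continuous_on UNIV ((deriv ^^ k) f)}"

definition tendsto_C_k ::
    "nat \<Rightarrow> (nat \<Rightarrow> real \<Rightarrow> real) \<Rightarrow> (real \<Rightarrow> real) \<Rightarrow> bool" where
  "tendsto_C_k k f g \<longleftrightarrow>
     (\<forall>j\<le>k. \<forall>K. compact K \<longrightarrow>
        uniform_limit K (\<lambda>n. (deriv ^^ j) (f n)) ((deriv ^^ j) g) sequentially)"

definition schwartz :: "(real \<Rightarrow> real) set" where
  "schwartz = {\<Phi>. (\<forall>k. \<Phi> \<in> C_k k) \<and>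
                  (\<forall>m k. bounded (range (\<lambda>x. x ^ m * (deriv ^^ k) \<Phi> x)))}"

text \<open>Mollifiers are not required to be nonnegative.\<close>

definition mollifier :: "(real \<Rightarrow> real) \<Rightarrow> bool" where
  "mollifier \<Phi> \<longleftrightarrow> \<Phi> \<in> schwartz \<and> (LINT x|lborel. \<Phi> x) = 1"

definition rescale :: "(real \<Rightarrow> real) \<Rightarrow> nat \<Rightarrow> real \<Rightarrow> real" where
  "rescale \<Phi> n x = real n * \<Phi> (real n * x)"

definition mollify :: "(real \<Rightarrow> real) \<Rightarrow> (real \<Rightarrow> real) \<Rightarrow> nat \<Rightarrow> real \<Rightarrow> real" where
  "mollify f \<Phi> n x = (LINT y|lborel. f y * rescale \<Phi> n (x - y))"

definition mollifiable :: "(real \<Rightarrow> real) \<Rightarrow> bool" where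
  "mollifiable f \<longleftrightarrow>
     (\<forall>\<Phi>. mollifier \<Phi> \<longrightarrow>
        (\<forall>n>0. \<forall>x. integrable lborel (\<lambda>y. f y * rescale \<Phi> n (x - y))))"

text \<open>For a signed mollifier the regularised coefficient of the second derivative may vanish
  somewhere, but on a given compact set it is positive for all large \<open>n\<close>. Hence the default
  values of the quotient and of the integral below do not affect limits in \<open>C\<^sup>0\<close>.\<close>

definition Sigma_n ::
    "(real \<Rightarrow> real) \<Rightarrow> (real \<Rightarrow> real) \<Rightarrow> (real \<Rightarrow> real) \<Rightarrow> nat \<Rightarrow> real \<Rightarrow> real" where
  "Sigma_n \<sigma> \<beta> \<Phi> n x =
     2 * (LBINT y=0..x. deriv (mollify \<beta> \<Phi> n) y / mollify (\<lambda>t. (\<sigma> t)\<^sup>2) \<Phi> n y)"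

definition has_Sigma :: "(real \<Rightarrow> real) \<Rightarrow> (real \<Rightarrow> real) \<Rightarrow> bool" where
  "has_Sigma \<sigma> \<beta> \<longleftrightarrow>
     (\<exists>S\<in>C_k 0. \<forall>\<Phi>. mollifier \<Phi> \<longrightarrow> tendsto_C_k 0 (Sigma_n \<sigma> \<beta> \<Phi>) S)"

definition L_n ::
    "(real \<Rightarrow> real) \<Rightarrow> (real \<Rightarrow> real) \<Rightarrow> (real \<Rightarrow> real) \<Rightarrow> nat \<Rightarrow> (real \<Rightarrow> real) \<Rightarrow> real \<Rightarrow> real" where
  "L_n \<sigma> \<beta> \<Phi> n g x =
     mollify (\<lambda>t. (\<sigma> t)\<^sup>2) \<Phi> n x / 2 * deriv (deriv g) x + deriv (mollify \<beta> \<Phi> n) x * deriv g x"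

text \<open>The equation is imposed for \<open>n \<ge> 1\<close> only, since \<open>rescale \<Phi> 0\<close> is zero.\<close>

definition C1_solution ::
    "(real \<Rightarrow> real) \<Rightarrow> (real \<Rightarrow> real) \<Rightarrow> (real \<Rightarrow> real) \<Rightarrow> (real \<Rightarrow> real) \<Rightarrow> bool" where
  "C1_solution \<sigma> \<beta> l f \<longleftrightarrow>
     l \<in> C_k 0 \<and> f \<in> C_k 1 \<and>
     (\<forall>\<Phi>. mollifier \<Phi> \<longrightarrow>
        (\<exists>fs ls. (\<forall>n. fs n \<in> C_k 2) \<and> (\<forall>n. ls n \<in> C_k 0) \<and>
                 (\<forall>n>0. L_n \<sigma> \<beta> \<Phi> n (fs n) = ls n) \<and>
                 tendsto_C_k 1 fs f \<and> tendsto_C_k 0 ls l))"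

text \<open>Functions on \<open>[a, b]\<close> are represented by total functions of which only the values on
  \<open>[a, b]\<close> are used.\<close>

definition linear_bvp_solution ::
    "(real \<Rightarrow> real) \<Rightarrow> (real \<Rightarrow> real) \<Rightarrow> real \<Rightarrow> real \<Rightarrow> (real \<Rightarrow> real) \<Rightarrow> real \<Rightarrow> real \<Rightarrow>
     (real \<Rightarrow> real) \<Rightarrow> bool" where
  "linear_bvp_solution \<sigma> \<beta> a b g A B u \<longleftrightarrow>
     (\<exists>g' u'. g' \<in> C_k 0 \<and> (\<forall>x\<in>{a..b}. g' x = g x) \<and>
              u' \<in> C_k 1 \<and> (\<forall>x\<in>{a..b}. u' x = u x) \<and>
              C1_solution \<sigma> \<beta> g' u' \<and> u' a = A \<and> u' b = B)"

text \<open>The derivative of \<open>u\<close> is one-sided at the end points of \<open>[a, b]\<close>.\<close>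

definition C1_on_interval :: "real \<Rightarrow> real \<Rightarrow> (real \<Rightarrow> real) \<Rightarrow> bool" where
  "C1_on_interval a b u \<longleftrightarrow>
     u differentiable_on {a..b} \<and>
     continuous_on {a..b} (\<lambda>x. vector_derivative u (at x within {a..b}))"

definition bvp_solution ::
    "(real \<Rightarrow> real) \<Rightarrow> (real \<Rightarrow> real) \<Rightarrow> real \<Rightarrow> real \<Rightarrow> (real \<Rightarrow> real \<Rightarrow> real \<Rightarrow> real) \<Rightarrow>
     real \<Rightarrow> real \<Rightarrow> (real \<Rightarrow> real) \<Rightarrow> bool" where
  "bvp_solution \<sigma> \<beta> a b F A B u \<longleftrightarrow>
     C1_on_interval a b u \<and>
     linear_bvp_solution \<sigma> \<beta> a b
       (\<lambda>x. F x (u x) (vector_derivative u (at x within {a..b}))) A B u"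

end

theory Submission
  imports Defs
begin

text \<open>
  Since \<open>S' = 2 b / s\<close> is an integrating factor, a solution of \<open>s/2 g'' + b g' = l\<close> satisfies
  \<open>g' = e\<^sup>-\<^sup>S (C + \<integral> 2 l e\<^sup>S / s)\<close>, and the right-hand side does not mention \<open>b\<close>. Passing to the limit
  in this formula with the mollified coefficients shows that its integrals, taken with \<open>s = \<sigma>\<^sup>2\<close> and
  \<open>S = \<Sigma>\<close>, are \<open>C\<^sup>1\<close>-solutions of \<open>L f = l\<close>.

  With \<open>l = F(x, u, u')\<close> the formula becomes an integral equation for \<open>v = u'\<close> with a free constant
  \<open>C\<close>. By the Lipschitz condition it is a contraction in an exponentially weighted supremum norm, so
  that it has a solution which depends continuously on \<open>C\<close>. As \<open>F\<close> is bounded, \<open>u(1)\<close> tends to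
  \<open>\<plusminus>\<infinity>\<close> with \<open>C\<close>, and the intermediate value theorem yields the second boundary value.
\<close>


subsection \<open>Schwartz functions\<close>

text \<open>All derivatives are supplied at once as the sequence \<open>D\<close>, which induction
  identifies with the iterates of \<open>deriv\<close>; so a concrete function never needs its
  iterated \<open>deriv\<close> evaluated.\<close>

lemma schwartzI:
  fixes D :: "nat \<Rightarrow> real \<Rightarrow> real"
  assumes deriv: "\<And>k x. (D k has_real_derivative D (Suc k) x) (at x)"
    and bd: "\<And>m k. bounded (range (\<lambda>x. x ^ m * D k x))"
  shows "D 0 \<in> schwartz"
proof -
  have D: "(deriv ^^ k) (D 0) = D k" for k
  proof (induction k)
    case (Suc k)
    have "deriv (D k) = D (Suc k)" using deriv by (intro ext DERIV_imp_deriv)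
    with Suc show ?case by simp
  qed simp
  have "continuous_on UNIV (D k)" for k
    by (rule DERIV_continuous_on) (rule deriv)
  moreover have "D k differentiable at x" for k x
    using deriv real_differentiable_def by blast
  ultimately show ?thesis
    unfolding schwartz_def C_k_def using bd by (simp add: D)
qed

lemma schwartz_deriv_funpow:
  assumes "\<Phi> \<in> schwartz"
  shows "((deriv ^^ k) \<Phi> has_real_derivative (deriv ^^ Suc k) \<Phi> x) (at x)"
proof -
  have "\<Phi> \<in> C_k (Suc k)" using assms by (auto simp: schwartz_def)
  then have "(deriv ^^ k) \<Phi> differentiable at x" by (auto simp: C_k_def)
  then show ?thesis by (simp add: DERIV_deriv_iff_real_differentiable)
qed

lemma schwartz_deriv:
  assumes "\<Phi> \<in> schwartz"
  shows "(\<Phi> has_real_derivative deriv \<Phi> x) (at x)"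
  using schwartz_deriv_funpow[OF assms, of 0] by simp

lemma schwartz_continuous: "\<Phi> \<in> schwartz \<Longrightarrow> continuous_on A \<Phi>"
  by (rule continuous_on_subset[OF DERIV_continuous_on subset_UNIV]) (rule schwartz_deriv)

lemma deriv_schwartz:
  assumes "\<Phi> \<in> schwartz"
  shows "deriv \<Phi> \<in> schwartz"
proof -
  let ?D = "\<lambda>k. (deriv ^^ Suc k) \<Phi>"
  have "?D 0 \<in> schwartz"
  proof (rule schwartzI)
    show "(?D k has_real_derivative ?D (Suc k) x) (at x)" for k x
      using schwartz_deriv_funpow[OF assms] by blast
    show "bounded (range (\<lambda>x. x ^ m * ?D k x))" for m k
      using assms unfolding schwartz_def by blast
  qed
  then show ?thesis by simp
qed

lemma schwartz_cmult:
  assumes "\<Phi> \<in> schwartz"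
  shows "(\<lambda>x. c * \<Phi> x) \<in> schwartz"
proof -
  have "(\<lambda>x. c * (deriv ^^ 0) \<Phi> x) \<in> schwartz"
  proof (rule schwartzI)
    show "((\<lambda>x. c * (deriv ^^ k) \<Phi> x) has_real_derivative c * (deriv ^^ Suc k) \<Phi> x) (at x)" for k x
      using schwartz_deriv_funpow[OF assms] by (intro DERIV_cmult)
    fix m k
    have "bounded (range (\<lambda>x. x ^ m * (deriv ^^ k) \<Phi> x))"
      using assms unfolding schwartz_def by blast
    then have "bounded ((\<lambda>y. c *\<^sub>R y) ` range (\<lambda>x. x ^ m * (deriv ^^ k) \<Phi> x))"
      by (rule bounded_scaling)
    then show "bounded (range (\<lambda>x. x ^ m * (c * (deriv ^^ k) \<Phi> x)))"
      by (simp add: image_image mult.left_commute)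
  qed
  then show ?thesis by simp
qed

lemma schwartz_decay:
  assumes "\<Phi> \<in> schwartz"
  obtains C where "C > 0" "\<And>x. \<bar>\<Phi> x\<bar> \<le> C / (1 + \<bar>x\<bar>) ^ m"
proof -
  have "bounded (range (\<lambda>x. x ^ m * (deriv ^^ 0) \<Phi> x))" for m
    using assms unfolding schwartz_def by blast
  then have "\<exists>C. \<forall>x. \<bar>x ^ m * \<Phi> x\<bar> \<le> C" for m
    by (auto simp: bounded_iff)
  from this[of m] this[of 0] obtain C D where C: "\<And>x. \<bar>x ^ m * \<Phi> x\<bar> \<le> C" and D: "\<And>x. \<bar>\<Phi> x\<bar> \<le> D"
    by auto
  \<comment> \<open>The estimate rests on \<open>(1 + |x|) ^ m \<le> 2 ^ m * (1 + |x| ^ m)\<close>;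
    the summand 1 in the constant makes it strictly positive.\<close>
  have "\<bar>\<Phi> x\<bar> \<le> (2 ^ m * (C + D) + 1) / (1 + \<bar>x\<bar>) ^ m" for x
  proof -
    have "(1 + \<bar>x\<bar>) ^ m \<le> (2 * max 1 \<bar>x\<bar>) ^ m" by (intro power_mono) auto
    also have "\<dots> = 2 ^ m * max 1 \<bar>x\<bar> ^ m" by (simp add: power_mult_distrib)
    also have "\<dots> \<le> 2 ^ m * (1 + \<bar>x\<bar> ^ m)"
      by (intro mult_left_mono) (auto simp: max_def)
    finally have "(1 + \<bar>x\<bar>) ^ m * \<bar>\<Phi> x\<bar> \<le> 2 ^ m * (1 + \<bar>x\<bar> ^ m) * \<bar>\<Phi> x\<bar>"
      by (intro mult_right_mono) auto
    also have "\<dots> = 2 ^ m * (\<bar>\<Phi> x\<bar> + \<bar>x ^ m * \<Phi> x\<bar>)"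
      by (simp add: algebra_simps abs_mult power_abs)
    also have "\<dots> \<le> 2 ^ m * (D + C)"
      using C[of x] D[of x] by (intro mult_left_mono) auto
    finally show ?thesis by (simp add: field_simps)
  qed
  moreover have "2 ^ m * (C + D) + 1 > 0"
    using order_trans[OF abs_ge_zero C] order_trans[OF abs_ge_zero D]
    by (simp add: add_nonneg_pos)
  ultimately show ?thesis using that by blast
qed

section \<open>The Gaussian and weighted sums of translates\<close>

lemma power_div_fact_le_exp:
  fixes t :: real
  assumes "t \<ge> 0"
  shows "t ^ m / fact m \<le> exp t"
proof -
  have "(\<Sum>k\<in>{m}. t ^ k /\<^sub>R fact k) \<le> (\<Sum>k. t ^ k /\<^sub>R fact k)"
    using assms summable_exp_generic[of t] by (intro sum_le_suminf) auto
  then show ?thesis by (simp add: exp_def divide_inverse mult.commute)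
qed

lemma bounded_poly_gauss: "bounded (range (\<lambda>x::real. poly p x * exp (- x\<^sup>2)))"
proof -
  have "\<bar>x ^ m * exp (- x\<^sup>2)\<bar> \<le> 1 + fact m" for x :: real and m
  proof -
    \<comment> \<open>Since \<open>(|x| ^ m - 1) ^ 2\<close> is nonnegative, an even power of
      \<open>x\<close> takes over, and one term of the exponential series at \<open>x ^ 2\<close>
      dominates it.\<close>
    have "\<bar>x\<bar> ^ m \<le> 1 + (\<bar>x\<bar> ^ m)\<^sup>2"
      using zero_le_power2[of "\<bar>x\<bar> ^ m - 1"] by (auto simp: power2_diff) (smt (verit) zero_le_power abs_ge_zero)
    also have "(\<bar>x\<bar> ^ m)\<^sup>2 = (x\<^sup>2) ^ m" by (metis power2_abs power_even_eq power_mult mult.commute)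
    also have "(x\<^sup>2) ^ m \<le> fact m * exp (x\<^sup>2)"
      using power_div_fact_le_exp[of "x\<^sup>2" m] by (simp add: field_simps)
    also have "1 \<le> exp (x\<^sup>2)" by simp
    finally have "\<bar>x\<bar> ^ m \<le> (1 + fact m) * exp (x\<^sup>2)" by (simp add: algebra_simps)
    then show ?thesis by (simp add: abs_mult power_abs exp_minus field_simps)
  qed
  then have *: "bounded (range (\<lambda>x::real. x ^ m * exp (- x\<^sup>2)))" for m
    by (intro boundedI[of _ "1 + fact m"]) auto
  \<comment> \<open>The exponent \<open>m\<close> is arbitrary in the induction:
    \<open>pCons a p\<close> is \<open>a + x * p\<close>, and its second summand raises
    \<open>m\<close> by one.\<close>
  have "bounded (range (\<lambda>x::real. x ^ m * (poly p x * exp (- x\<^sup>2))))" for m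
  proof (induction p arbitrary: m)
    case (pCons a p)
    have "bounded ((\<lambda>y. a *\<^sub>R y) ` range (\<lambda>x::real. x ^ m * exp (- x\<^sup>2)))"
      by (intro bounded_scaling *)
    then have "bounded (range (\<lambda>x. a * (x ^ m * exp (- x\<^sup>2))))" by (simp add: image_image)
    from bounded_plus_comp[OF this pCons.IH[of "Suc m"]] show ?case
      by (simp add: algebra_simps)
  qed simp
  from this[of 0] show ?thesis by simp
qed

text \<open>The polynomial factor of the \<open>k\<close>-th derivative of
  \<open>exp (- x ^ 2)\<close>, that is, \<open>(-1) ^ k\<close> times the \<open>k\<close>-th
  (physicists') Hermite polynomial.\<close>

primrec gauss_poly :: "nat \<Rightarrow> real poly" where
  "gauss_poly 0 = 1"
| "gauss_poly (Suc k) = pderiv (gauss_poly k) - [:0, 2:] * gauss_poly k"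

lemma gauss_schwartz: "(\<lambda>x::real. exp (- x\<^sup>2)) \<in> schwartz"
proof -
  have "(\<lambda>x. poly (gauss_poly 0) x * exp (- x\<^sup>2)) \<in> schwartz"
  proof (rule schwartzI)
    show "((\<lambda>x. poly (gauss_poly k) x * exp (- x\<^sup>2)) has_real_derivative
       poly (gauss_poly (Suc k)) x * exp (- x\<^sup>2)) (at x)" for k x
      by (auto intro!: derivative_eq_intros poly_DERIV simp: algebra_simps)
    show "bounded (range (\<lambda>x. x ^ m * (poly (gauss_poly k) x * exp (- x\<^sup>2))))" for m k
      using bounded_poly_gauss[of "monom 1 m * gauss_poly k"]
      by (simp add: poly_monom mult.assoc)
  qed
  then show ?thesis by simp
qed

text \<open>Termwise differentiation is justified by the Weierstrass test, all derivatives of \<Phi>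
  being bounded. For the decay, \<open>|x| ^ m\<close> is at most
  \<open>2 ^ m * (|x + t k| ^ m + |t k| ^ m)\<close>: the first term is absorbed by the decay of
  \<Phi>, the second by the moment condition on \<open>a\<close>.\<close>

lemma schwartz_suminf_translates:
  fixes a t :: "nat \<Rightarrow> real"
  assumes \<Phi>: "\<Phi> \<in> schwartz" and a: "\<And>k. a k \<ge> 0" and sm: "\<And>m. summable (\<lambda>k. a k * \<bar>t k\<bar> ^ m)"
  shows "(\<lambda>x. \<Sum>k. a k * \<Phi> (x + t k)) \<in> schwartz" and "summable (\<lambda>k. a k * \<Phi> (x + t k))"
proof -
  define D where "D j x = (\<Sum>k. a k * (deriv ^^ j) \<Phi> (x + t k))" for j x
  have bd: "\<exists>C\<ge>0. \<forall>x. \<bar>x ^ m * (deriv ^^ j) \<Phi> x\<bar> \<le> C" for m j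
  proof -
    have "bounded (range (\<lambda>x. x ^ m * (deriv ^^ j) \<Phi> x))"
      using \<Phi> unfolding schwartz_def by blast
    then show ?thesis by (auto simp: bounded_iff) (meson abs_ge_zero order_trans)
  qed
  have sa: "summable a" using sm[of 0] by simp
  have summ: "summable (\<lambda>k. a k * (deriv ^^ j) \<Phi> (x + t k))" for j x
  proof -
    obtain C where "\<And>x. \<bar>(deriv ^^ j) \<Phi> x\<bar> \<le> C" using bd[of 0 j] by auto
    then show ?thesis
      by (intro summable_comparison_test'[OF summable_mult2[OF sa, of C], of 0])
         (simp add: abs_mult a mult_left_mono)
  qed
  show "summable (\<lambda>k. a k * \<Phi> (x + t k))" using summ[of 0] by simp
  have der: "(D j has_real_derivative D (Suc j) x) (at x)" for j x
    unfolding D_def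
  proof (rule has_field_derivative_series'(2)[where S = UNIV and ?x0.0 = 0])
    fix n y
    show "((\<lambda>x. a n * (deriv ^^ j) \<Phi> (x + t n)) has_real_derivative a n * (deriv ^^ Suc j) \<Phi> (y + t n))
       (at y within UNIV)"
      using schwartz_deriv_funpow[OF \<Phi>, of j] DERIV_shift by (intro DERIV_cmult) blast
  next
    obtain C where "\<And>x. \<bar>(deriv ^^ Suc j) \<Phi> x\<bar> \<le> C" using bd[of 0 "Suc j"] by auto
    then show "uniformly_convergent_on UNIV (\<lambda>n x. \<Sum>i<n. a i * (deriv ^^ Suc j) \<Phi> (x + t i))"
      by (intro Weierstrass_m_test'[where M = "\<lambda>i. a i * C"] summable_mult2 sa)
         (simp add: abs_mult a mult_left_mono)
  qed (use summ[of j 0] in auto)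
  have "D 0 \<in> schwartz"
  proof (rule schwartzI)
    show "(D j has_real_derivative D (Suc j) x) (at x)" for j x by (rule der)
    fix m j
    obtain C where C: "\<And>x. \<bar>x ^ m * (deriv ^^ j) \<Phi> x\<bar> \<le> C" using bd by blast
    obtain C0 where C0: "\<And>x. \<bar>(deriv ^^ j) \<Phi> x\<bar> \<le> C0" using bd[of 0] by auto
    let ?b = "\<lambda>k. 2 ^ m * C * a k + 2 ^ m * C0 * (a k * \<bar>t k\<bar> ^ m)"
    have sb: "summable ?b" by (intro summable_add summable_mult sa sm)
    have "\<bar>x ^ m * D j x\<bar> \<le> suminf ?b" for x
    proof -
      have *: "\<bar>x ^ m * (a k * (deriv ^^ j) \<Phi> (x + t k))\<bar> \<le> ?b k" for k
      proof -
        have "\<bar>x\<bar> ^ m \<le> (2 * max \<bar>x + t k\<bar> \<bar>t k\<bar>) ^ m"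
            by (intro power_mono) (auto simp: max_def abs_if)
        also have "\<dots> = 2 ^ m * max \<bar>x + t k\<bar> \<bar>t k\<bar> ^ m" by (simp add: power_mult_distrib)
        also have "\<dots> \<le> 2 ^ m * (\<bar>x + t k\<bar> ^ m + \<bar>t k\<bar> ^ m)"
          by (intro mult_left_mono) (auto simp: max_def)
        finally have "\<bar>x\<bar> ^ m * \<bar>(deriv ^^ j) \<Phi> (x + t k)\<bar>
            \<le> 2 ^ m * (\<bar>x + t k\<bar> ^ m + \<bar>t k\<bar> ^ m) * \<bar>(deriv ^^ j) \<Phi> (x + t k)\<bar>"
          by (intro mult_right_mono) auto
        also have "\<dots> = 2 ^ m * (\<bar>(x + t k) ^ m * (deriv ^^ j) \<Phi> (x + t k)\<bar>
            + \<bar>t k\<bar> ^ m * \<bar>(deriv ^^ j) \<Phi> (x + t k)\<bar>)"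
          by (simp add: abs_mult power_abs algebra_simps)
        also have "\<dots> \<le> 2 ^ m * (C + \<bar>t k\<bar> ^ m * C0)"
          by (intro mult_left_mono add_mono C C0) auto
        finally have "a k * (\<bar>x\<bar> ^ m * \<bar>(deriv ^^ j) \<Phi> (x + t k)\<bar>) \<le> a k * (2 ^ m * (C + \<bar>t k\<bar> ^ m * C0))"
          by (intro mult_left_mono a)
        then show ?thesis using a[of k] by (simp add: abs_mult power_abs algebra_simps)
      qed
      have sx: "summable (\<lambda>k. \<bar>x ^ m * (a k * (deriv ^^ j) \<Phi> (x + t k))\<bar>)"
        by (rule summable_comparison_test'[OF sb]) (use * in auto)
      have "\<bar>x ^ m * D j x\<bar> = \<bar>\<Sum>k. x ^ m * (a k * (deriv ^^ j) \<Phi> (x + t k))\<bar>"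
        unfolding D_def by (subst suminf_mult[OF summ]) simp
      also have "\<dots> \<le> (\<Sum>k. \<bar>x ^ m * (a k * (deriv ^^ j) \<Phi> (x + t k))\<bar>)"
        using sx by (rule summable_rabs)
      also have "\<dots> \<le> suminf ?b" using * sx sb by (rule suminf_le)
      finally show ?thesis .
    qed
    then show "bounded (range (\<lambda>x. x ^ m * D j x))"
      by (intro boundedI[of _ "suminf ?b"]) auto
  qed
  then show "(\<lambda>x. \<Sum>k. a k * \<Phi> (x + t k)) \<in> schwartz" by (simp add: D_def[abs_def])
qed

subsection \<open>Growth of mollifiable functions\<close>

text \<open>The line is cut into unit intervals. The two at distance \<open>j\<close> from 0
  contribute at most a constant times \<open>(1 + j) ^ N / (1 + j) ^ (N + 2)\<close>, so the two
  extra powers in the weight make the series converge.\<close>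

lemma integrable_weight:
  fixes f :: "real \<Rightarrow> real"
  assumes f: "continuous_on UNIV f"
    and growth: "\<And>t. (LINT y:{t..t+1}|lborel. \<bar>f y\<bar>) \<le> C * (1 + \<bar>t\<bar>) ^ N"
  shows "integrable lborel (\<lambda>y. \<bar>f y\<bar> / (1 + \<bar>y\<bar>) ^ (N + 2))"
proof -
  have [measurable]: "f \<in> borel_measurable borel" using f by (rule borel_measurable_continuous_onI)
  have af: "continuous_on A (\<lambda>y. \<bar>f y\<bar>)" for A
    using continuous_on_subset[OF f] by (intro continuous_intros) auto
  have int: "integrable lborel (\<lambda>y. indicat_real {t..t+1} y * \<bar>f y\<bar>)" for t
    using borel_integrable_atLeastAtMost'[OF af, of t "t+1"] by (simp add: set_integrable_def)
  have C: "0 \<le> C"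
    using growth[of 0] by (intro order_trans[OF _ growth[of 0, simplified]])
       (auto simp: set_lebesgue_integral_def intro!: integral_nonneg_AE)
  define c where "c j = 1 / (1 + real j) ^ (N + 2)" for j
  \<comment> \<open>The second interval is \<open>[-(j+1), -j]\<close>, written in the form
    \<open>{t..t+1}\<close> that \<open>growth\<close> speaks of.\<close>
  define g where "g j y = c j * (indicator {real j..real j+1} y * \<bar>f y\<bar> + indicator {-(real j+1)..-(real j+1)+1} y * \<bar>f y\<bar>)"
    for j y
  have g_nn: "0 \<le> g j y" for j y by (simp add: g_def c_def)
  have g_int: "integrable lborel (g j)" for j
    unfolding g_def by (intro integrable_mult_right Bochner_Integration.integrable_add int)
  have g_le: "(LINT y|lborel. norm (g j y)) \<le> C * (1 + 2 ^ N) * inverse (real (Suc j) ^ 2)" for j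
  proof -
    have "(LINT y|lborel. norm (g j y)) = c j * ((LINT y:{real j..real j+1}|lborel. \<bar>f y\<bar>)
        + (LINT y:{-(real j+1)..-(real j+1)+1}|lborel. \<bar>f y\<bar>))"
      unfolding set_lebesgue_integral_def real_scaleR_def Bochner_Integration.integral_add[OF int int, symmetric]
        Bochner_Integration.integral_mult_right_zero[symmetric]
      using g_nn by (simp add: g_def)
    also have "\<dots> \<le> c j * (C * (1 + \<bar>real j\<bar>) ^ N + C * (1 + \<bar>-(real j+1)\<bar>) ^ N)"
      by (intro mult_left_mono add_mono growth) (simp add: c_def)
    also have "\<dots> \<le> c j * (C * (1 + real j) ^ N + C * (2 * (1 + real j)) ^ N)"
      using C by (intro mult_left_mono add_mono power_mono) (auto simp: c_def)
    also have "\<dots> = C * (1 + 2 ^ N) * inverse (real (Suc j) ^ 2)"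
    proof -
      have "c j * (1 + real j) ^ N = inverse (real (Suc j) ^ 2)"
        unfolding c_def power_add by (simp add: divide_simps)
      moreover have "c j * (C * (1 + real j) ^ N + C * (2 * (1 + real j)) ^ N)
          = C * (1 + 2 ^ N) * (c j * (1 + real j) ^ N)"
        unfolding power_mult_distrib by (simp only: algebra_simps)
      ultimately show ?thesis by (simp only:)
    qed
    finally show ?thesis .
  qed
  have g_fin: "summable (\<lambda>j. norm (g j y))" for y
  proof -
    \<comment> \<open>Intervals with \<open>j\<close> beyond the integer part of \<open>|y|\<close>
      miss \<open>y\<close>, so at each point the series is a finite sum.\<close>
    have "g j y = 0" if "j > nat \<lfloor>\<bar>y\<bar>\<rfloor>" for j
      using that by (auto simp: g_def indicator_def) linarith+
    then show ?thesis
      by (intro summable_finite[of "{..nat \<lfloor>\<bar>y\<bar>\<rfloor>}"]) auto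
  qed
  have "summable (\<lambda>j. inverse (real (Suc j) ^ 2))"
    using inverse_power_summable[of 2, where ?'a = real] by (subst summable_Suc_iff) simp
  then have "summable (\<lambda>j. C * (1 + 2 ^ N) * inverse (real (Suc j) ^ 2))" by (rule summable_mult)
  then have "summable (\<lambda>j. LINT y|lborel. norm (g j y))"
    by (rule summable_comparison_test'[where N = 0])
       (use g_le in \<open>auto simp: integral_nonneg_AE\<close>)
  then have "integrable lborel (\<lambda>y. \<Sum>j. g j y)"
    by (intro integrable_suminf g_int) (use g_fin in auto)
  then show ?thesis
  proof (rule Bochner_Integration.integrable_bound)
    show "AE y in lborel. norm (\<bar>f y\<bar> / (1 + \<bar>y\<bar>) ^ (N + 2)) \<le> norm (\<Sum>j. g j y)"
    proof (rule AE_I2)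
      fix y :: real
      define j where "j = nat \<lfloor>\<bar>y\<bar>\<rfloor>"
      have j: "real j \<le> \<bar>y\<bar>" "\<bar>y\<bar> \<le> real j + 1" unfolding j_def by linarith+
      have "\<bar>f y\<bar> / (1 + \<bar>y\<bar>) ^ (N + 2) \<le> \<bar>f y\<bar> / (1 + real j) ^ (N + 2)"
        using j by (intro divide_left_mono power_mono mult_pos_pos zero_less_power) auto
      also have "\<dots> \<le> g j y"
        using j by (cases "y \<ge> 0") (auto simp: g_def c_def indicator_def divide_right_mono)
      also have "\<dots> = (\<Sum>i\<in>{j}. g i y)" by simp
      also have "\<dots> \<le> (\<Sum>i. g i y)"
        using g_fin[of y] g_nn by (intro sum_le_suminf) auto
      finally show "norm (\<bar>f y\<bar> / (1 + \<bar>y\<bar>) ^ (N + 2)) \<le> norm (\<Sum>j. g j y)" by simp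
    qed
  qed measurable
qed

lemma schwartz_integrable:
  assumes "\<Phi> \<in> schwartz"
  shows "integrable lborel \<Phi>"
proof -
  \<comment> \<open>The constant function 1 with \<open>N = 0\<close> yields the integrability of
    \<open>1 / (1 + |y|) ^ 2\<close>.\<close>
  have "integrable lborel (\<lambda>y. \<bar>1\<bar> / (1 + \<bar>y\<bar>) ^ (0 + 2) :: real)"
    by (rule integrable_weight[where C = 1]) (auto simp: set_lebesgue_integral_def)
  then have w: "integrable lborel (\<lambda>y::real. C * (\<bar>1\<bar> / (1 + \<bar>y\<bar>) ^ (0 + 2)))" for C
    by (rule integrable_mult_right)
  obtain C where "C > 0" and C: "\<And>x. \<bar>\<Phi> x\<bar> \<le> C / (1 + \<bar>x\<bar>) ^ 2"
    by (rule schwartz_decay[OF assms, of 2]) (rule that)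
  then show ?thesis
    using borel_measurable_continuous_onI[OF schwartz_continuous[OF assms]]
    by (intro Bochner_Integration.integrable_bound[OF w[of C]])
       (auto simp: power2_eq_square intro!: AE_I2)
qed

text \<open>If the local integrals of \<open>\<bar>f\<bar>\<close> outgrow every polynomial along points \<open>t k\<close>, the Schwartz
  function built from small multiples of Gaussians centred there cannot be integrated against \<open>f\<close>.\<close>

lemma mollifiable_weight:
  fixes f :: "real \<Rightarrow> real"
  assumes f: "continuous_on UNIV f" and "mollifiable f"
  obtains N where "N \<ge> 2" "integrable lborel (\<lambda>y. \<bar>f y\<bar> / (1 + \<bar>y\<bar>) ^ N)"
proof (cases "\<exists>N. \<forall>t. (LINT y:{t..t+1}|lborel. \<bar>f y\<bar>) \<le> 2 ^ N * (1 + \<bar>t\<bar>) ^ N")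
  case True
  then obtain N where "\<And>t. (LINT y:{t..t+1}|lborel. \<bar>f y\<bar>) \<le> 2 ^ N * (1 + \<bar>t\<bar>) ^ N" by blast
  from integrable_weight[OF f this] show ?thesis by (intro that[of "N + 2"]) auto
next
  case False
  then have "\<forall>N. \<exists>t. (LINT y:{t..t+1}|lborel. \<bar>f y\<bar>) > 2 ^ N * (1 + \<bar>t\<bar>) ^ N" by (meson not_le)
  then obtain t where t: "\<And>k. (LINT y:{t k..t k+1}|lborel. \<bar>f y\<bar>) > 2 ^ k * (1 + \<bar>t k\<bar>) ^ k" by metis
  have [measurable]: "f \<in> borel_measurable borel" using f by (rule borel_measurable_continuous_onI)
  have af: "continuous_on A (\<lambda>y. \<bar>f y\<bar>)" for A
    using continuous_on_subset[OF f] by (intro continuous_intros) auto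
  have int: "integrable lborel (\<lambda>y. indicat_real {t..t+1} y * \<bar>f y\<bar>)" for t
    using borel_integrable_atLeastAtMost'[OF af, of t "t+1"] by (simp add: set_integrable_def)
  \<comment> \<open>The reciprocal of the bound violated at \<open>t k\<close>, so that
    \<open>a k\<close> times the local integral exceeds 1. The factor \<open>2 ^ k\<close> gives
    summability, and \<open>(1 + |t k|) ^ k\<close> beats \<open>|t k| ^ m\<close> as soon as
    \<open>k \<ge> m\<close>.\<close>
  define a where "a k = 1 / (2 ^ k * (1 + \<bar>t k\<bar>) ^ k)" for k
  have a: "a k > 0" for k by (auto simp: a_def intro!: divide_pos_pos mult_pos_pos)
  have sm: "summable (\<lambda>k. a k * \<bar>t k\<bar> ^ m)" for m
  proof (rule summable_comparison_test'[where N = m])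
    show "summable (\<lambda>k. (1/2::real) ^ k)" by (rule summable_geometric) simp
    fix k assume "m \<le> k"
    have "\<bar>t k\<bar> ^ m \<le> (1 + \<bar>t k\<bar>) ^ m" by (intro power_mono) auto
    also have "\<dots> \<le> (1 + \<bar>t k\<bar>) ^ k" using \<open>m \<le> k\<close> by (intro power_increasing) auto
    finally show "norm (a k * \<bar>t k\<bar> ^ m) \<le> (1/2) ^ k"
      by (simp add: a_def abs_mult power_one_over divide_simps)
  qed
  let ?G = "\<lambda>x::real. exp (- x\<^sup>2)"
  define \<Psi> where "\<Psi> x = (\<Sum>k. a k * ?G (x + t k))" for x
  note sch = schwartz_suminf_translates[OF gauss_schwartz less_imp_le[OF a] sm]
  have \<Psi>: "\<Psi> \<in> schwartz" using sch(1) by (simp add: \<Psi>_def[abs_def])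
  have lower: "(\<Sum>k<n. a k * ?G (x + t k)) \<le> \<Psi> x" for x n
    unfolding \<Psi>_def 
  proof (rule sum_le_suminf)
    show "summable (\<lambda>k. a k * ?G (x + t k))" by (rule sch(2))
    show "0 \<le> a k * ?G (x + t k)" for k using a[of k] by simp
  qed simp
  have \<Psi>0: "\<Psi> x > 0" for x
  proof -
    have "0 < a 0 * ?G (x + t 0)" using a[of 0] by simp
    also have "\<dots> \<le> \<Psi> x" using lower[where n = 1 and x = x] by simp
    finally show ?thesis .
  qed
  define I where "I = (LINT x|lborel. \<Psi> x)"
  \<comment> \<open>Needed to normalise \<Psi> to a mollifier: a nonnegative function with integral
    0 vanishes almost everywhere, but \<Psi> is positive on the whole line.\<close>
  have "I \<noteq> 0"
  proof
    assume "I = 0"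
    then have "AE x in lborel. \<Psi> x = 0"
      using integral_nonneg_eq_0_iff_AE[OF schwartz_integrable[OF \<Psi>]] \<Psi>0 by (auto simp: I_def less_imp_le)
    then have "AE x in lborel. x \<notin> (UNIV :: real set)" by (rule AE_mp) (simp add: less_imp_neq[OF \<Psi>0, symmetric])
    then have "(UNIV :: real set) \<in> null_sets lborel" by (subst AE_iff_null_sets) simp_all
    then show False by (simp add: null_sets_def)
  qed
  define \<Phi> where "\<Phi> x = (1 / I) * \<Psi> x" for x
  have "\<Phi> \<in> schwartz" unfolding \<Phi>_def by (rule schwartz_cmult[OF \<Psi>])
  moreover have "(LINT x|lborel. \<Phi> x) = 1" using \<open>I \<noteq> 0\<close> unfolding \<Phi>_def by (simp flip: I_def)
  ultimately have "mollifier \<Phi>" by (simp add: mollifier_def)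
  \<comment> \<open>At \<open>n = 1\<close> and \<open>x = 0\<close> the kernel is
    \<open>\<Phi> (- y)\<close>; as the translates are by \<open>+ t k\<close>, its
    \<open>k\<close>-th bump is centred at \<open>y = t k\<close>.\<close>
  then have "integrable lborel (\<lambda>y. f y * rescale \<Phi> 1 (0 - y))"
    using assms(2)[unfolded mollifiable_def, rule_format, of \<Phi> 1 0] by simp
  then have "integrable lborel (\<lambda>y. I * \<bar>f y * rescale \<Phi> 1 (0 - y)\<bar>)"
    by (intro integrable_mult_right integrable_abs)
  then have "integrable lborel (\<lambda>y. \<bar>I * \<bar>f y * rescale \<Phi> 1 (0 - y)\<bar>\<bar>)" by (rule integrable_abs)
  moreover have "\<bar>I * \<bar>f y * rescale \<Phi> 1 (0 - y)\<bar>\<bar> = \<bar>f y\<bar> * \<Psi> (- y)" for y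
    using \<open>I \<noteq> 0\<close> \<Psi>0[of "-y"] by (simp add: rescale_def \<Phi>_def abs_mult)
  ultimately have int\<Psi>: "integrable lborel (\<lambda>y. \<bar>f y\<bar> * \<Psi> (- y))" by simp
  \<comment> \<open>Every term contributes at least \<open>exp (-1)\<close>, the least value on
    \<open>{t k..t k+1}\<close> of the Gaussian centred at \<open>t k\<close>. The integral would
    thus be at least \<open>n * exp (-1)\<close> for every \<open>n\<close>.\<close>
  obtain n where n: "(LINT y|lborel. \<bar>f y\<bar> * \<Psi> (- y)) < real n * exp (-1)"
    using reals_Archimedean3[of "exp (-1::real)"] by auto
  have "real n * exp (-1) = (\<Sum>k<n. a k * exp (-1) * (1 / a k))"
    using less_imp_neq[OF a] by simp
  also have "\<dots> \<le> (\<Sum>k<n. a k * exp (-1) * (LINT y:{t k..t k+1}|lborel. \<bar>f y\<bar>))"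
  proof (intro sum_mono mult_left_mono)
    show "1 / a k \<le> (LINT y:{t k..t k+1}|lborel. \<bar>f y\<bar>)" for k using t[of k] by (simp add: a_def)
    show "0 \<le> a k * exp (-1)" for k using a[of k] by simp
  qed
  also have "\<dots> = (LINT y|lborel. (\<Sum>k<n. a k * exp (-1) * (indicator {t k..t k+1} y * \<bar>f y\<bar>)))"
    using int by (simp add: set_lebesgue_integral_def)
  also have "\<dots> \<le> (LINT y|lborel. \<bar>f y\<bar> * \<Psi> (- y))"
  proof (rule integral_mono)
    fix y
    have "(\<Sum>k<n. a k * exp (-1) * (indicator {t k..t k+1} y * \<bar>f y\<bar>)) \<le> (\<Sum>k<n. \<bar>f y\<bar> * (a k * ?G (- y + t k)))"
    proof (rule sum_mono)
      fix k
      have "exp (-1) \<le> ?G (- y + t k)" if "y \<in> {t k..t k+1}"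
      proof -
        have "\<bar>- y + t k\<bar> \<le> 1" using that by auto
        then have "(- y + t k)\<^sup>2 \<le> 1" by (simp add: abs_square_le_1)
        then show ?thesis by simp
      qed
      then have "\<bar>f y\<bar> * a k * (indicator {t k..t k+1} y * exp (-1)) \<le> \<bar>f y\<bar> * a k * ?G (- y + t k)"
        using a[of k] by (intro mult_left_mono) (auto simp: indicator_def)
      then show "a k * exp (-1) * (indicator {t k..t k+1} y * \<bar>f y\<bar>) \<le> \<bar>f y\<bar> * (a k * ?G (- y + t k))"
        by (simp add: mult_ac)
    qed
    also have "\<dots> \<le> \<bar>f y\<bar> * \<Psi> (- y)"
      unfolding sum_distrib_left[symmetric] by (intro mult_left_mono lower) auto
    finally show "(\<Sum>k<n. a k * exp (-1) * (indicator {t k..t k+1} y * \<bar>f y\<bar>)) \<le> \<bar>f y\<bar> * \<Psi> (- y)" .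
  qed (use int int\<Psi> in auto)
  finally show ?thesis using n by simp
qed

subsection \<open>Mollification\<close>

text \<open>The inequality \<open>1 + |y| \<le> (1 + M) * (1 + |x - y|)\<close> moves the decay from
  \<open>x - y\<close> to \<open>y\<close>, and \<open>c \<ge> 1\<close> can only improve it. Being
  uniform in \<open>c\<close> and in \<open>|x| \<le> M\<close>, the bound serves for dominated
  convergence.\<close>

lemma schwartz_kernel_bound:
  assumes "\<Phi> \<in> schwartz"
  obtains C where "C > 0"
    "\<And>c x y M. c \<ge> 1 \<Longrightarrow> \<bar>x\<bar> \<le> M \<Longrightarrow> \<bar>\<Phi> (c * (x - y))\<bar> \<le> C * (1 + M) ^ N / (1 + \<bar>y\<bar>) ^ N"
proof -
  obtain C where C: "C > 0" "\<And>z. \<bar>\<Phi> z\<bar> \<le> C / (1 + \<bar>z\<bar>) ^ N"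
    using schwartz_decay[OF assms] by metis
  have "\<bar>\<Phi> (c * (x - y))\<bar> \<le> C * (1 + M) ^ N / (1 + \<bar>y\<bar>) ^ N" if "c \<ge> 1" "\<bar>x\<bar> \<le> M" for c x y M
  proof -
    have "1 + \<bar>y\<bar> \<le> 1 + M + \<bar>x - y\<bar>" using that by auto
    also have "\<dots> \<le> (1 + M) * (1 + \<bar>x - y\<bar>)" using that by (simp add: algebra_simps)
    also have "\<dots> \<le> (1 + M) * (1 + \<bar>c * (x - y)\<bar>)"
      using that mult_right_mono[OF that(1), of "\<bar>x - y\<bar>"] by (intro mult_left_mono) (auto simp: abs_mult)
    finally have "(1 + \<bar>y\<bar>) ^ N \<le> (1 + M) ^ N * (1 + \<bar>c * (x - y)\<bar>) ^ N"
      unfolding power_mult_distrib[symmetric] by (intro power_mono) auto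
    then have "C * (1 + \<bar>y\<bar>) ^ N \<le> C * ((1 + M) ^ N * (1 + \<bar>c * (x - y)\<bar>) ^ N)"
      using C(1) by (intro mult_left_mono) auto
    then have "C / (1 + \<bar>c * (x - y)\<bar>) ^ N \<le> C * (1 + M) ^ N / (1 + \<bar>y\<bar>) ^ N"
      by (simp add: divide_simps mult_ac)
    with C(2) show ?thesis by (rule order_trans)
  qed
  with C(1) show ?thesis by (rule that)
qed

context
  fixes f :: "real \<Rightarrow> real" and N :: nat
  assumes f: "continuous_on UNIV f"
    and weight: "integrable lborel (\<lambda>y. \<bar>f y\<bar> / (1 + \<bar>y\<bar>) ^ N)"
begin

lemma measurable_of_continuous [measurable]: "f \<in> borel_measurable borel"
  using f by (rule borel_measurable_continuous_onI)

lemma integrable_against_schwartz: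
  assumes \<Phi>: "\<Phi> \<in> schwartz" and c: "c \<ge> 1"
  shows "integrable lborel (\<lambda>y. f y * \<Phi> (c * (x - y)))"
proof -
  obtain C where C: "\<And>c x y M. c \<ge> 1 \<Longrightarrow> \<bar>x\<bar> \<le> M \<Longrightarrow> \<bar>\<Phi> (c * (x - y))\<bar> \<le> C * (1 + M) ^ N / (1 + \<bar>y\<bar>) ^ N"
    by (rule schwartz_kernel_bound[OF \<Phi>, where N = N]) (rule that)
  have [measurable]: "\<Phi> \<in> borel_measurable borel"
    using schwartz_continuous[OF \<Phi>] by (rule borel_measurable_continuous_onI)
  have "\<bar>f y * \<Phi> (c * (x - y))\<bar> \<le> C * (1 + \<bar>x\<bar>) ^ N * (\<bar>f y\<bar> / (1 + \<bar>y\<bar>) ^ N)" for y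
    using mult_left_mono[OF C[OF c order_refl, of x y], of "\<bar>f y\<bar>"] by (simp add: abs_mult mult_ac)
  then have "norm (f y * \<Phi> (c * (x - y))) \<le> norm (C * (1 + \<bar>x\<bar>) ^ N * (\<bar>f y\<bar> / (1 + \<bar>y\<bar>) ^ N))" for y
    unfolding real_norm_def by (rule order_trans[OF _ abs_ge_self])
  then show ?thesis
    by (intro Bochner_Integration.integrable_bound[OF integrable_mult_right[OF weight, of "C * (1 + \<bar>x\<bar>) ^ N"]] AE_I2)
       measurable
qed

text \<open>Differentiation under the integral sign, along sequences \<open>X\<close> so that
  dominated convergence applies. The mean value inequality and the decay of
  \<open>deriv \<Phi>\<close> bound the difference quotients by a multiple of the weight.\<close>

lemma convolution_has_derivative:
  assumes \<Phi>: "\<Phi> \<in> schwartz" and c: "c \<ge> 1"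
  shows "((\<lambda>x. LINT y|lborel. f y * \<Phi> (c * (x - y))) has_real_derivative
           (LINT y|lborel. f y * (c * deriv \<Phi> (c * (x - y))))) (at x)"
  unfolding has_field_derivative_iff tendsto_at_iff_sequentially
proof (intro allI impI)
  fix X assume "\<forall>i::nat. X i \<in> UNIV - {x}" and X: "X \<longlonglongrightarrow> x"
  then have Xne: "X i \<noteq> x" for i by auto
  have [measurable]: "\<Phi> \<in> borel_measurable borel" "deriv \<Phi> \<in> borel_measurable borel"
    using schwartz_continuous[OF \<Phi>] schwartz_continuous[OF deriv_schwartz[OF \<Phi>]]
    by (auto intro: borel_measurable_continuous_onI)
  \<comment> \<open>A common bound \<open>M\<close> for the sequence and its limit makes the
    domination independent of \<open>i\<close>.\<close>
  have "bounded (range X)" using X convergent_imp_bounded by blast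
  then obtain M0 where M0: "\<And>i. \<bar>X i\<bar> \<le> M0" by (auto simp: bounded_iff)
  define M where "M = max M0 \<bar>x\<bar>"
  have M: "\<bar>X i\<bar> \<le> M" "\<bar>x\<bar> \<le> M" for i using M0[of i] by (auto simp: M_def)
  obtain C where C: "\<And>c x y M. c \<ge> 1 \<Longrightarrow> \<bar>x\<bar> \<le> M \<Longrightarrow> \<bar>deriv \<Phi> (c * (x - y))\<bar> \<le> C * (1 + M) ^ N / (1 + \<bar>y\<bar>) ^ N"
    by (rule schwartz_kernel_bound[OF deriv_schwartz[OF \<Phi>], where N = N]) (rule that)
  have der: "((\<lambda>x. \<Phi> (c * (x - y))) has_real_derivative c * deriv \<Phi> (c * (z - y))) (at z within A)" for y z A
  proof -
    have "((\<lambda>x. c * (x - y)) has_real_derivative c) (at z)" by (auto intro!: derivative_eq_intros)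
    from DERIV_chain'[OF this schwartz_deriv[OF \<Phi>]] show ?thesis
      by (subst mult.commute) (rule DERIV_subset[OF _ subset_UNIV])
  qed
  let ?q = "\<lambda>i y. f y * ((\<Phi> (c * (X i - y)) - \<Phi> (c * (x - y))) / (X i - x))"
  have bnd: "\<bar>?q i y\<bar> \<le> c * C * (1 + M) ^ N * (\<bar>f y\<bar> / (1 + \<bar>y\<bar>) ^ N)" for i y
  proof -
    have "norm (\<Phi> (c * (X i - y)) - \<Phi> (c * (x - y))) \<le> c * (C * (1 + M) ^ N / (1 + \<bar>y\<bar>) ^ N) * norm (X i - x)"
    proof (rule field_differentiable_bound[OF _ der])
      show "convex {-M..M}" by simp
      show "norm (c * deriv \<Phi> (c * (z - y))) \<le> c * (C * (1 + M) ^ N / (1 + \<bar>y\<bar>) ^ N)" if "z \<in> {-M..M}" for z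
      proof -
        have "\<bar>deriv \<Phi> (c * (z - y))\<bar> \<le> C * (1 + M) ^ N / (1 + \<bar>y\<bar>) ^ N"
          using that by (intro C c) auto
        then have "c * \<bar>deriv \<Phi> (c * (z - y))\<bar> \<le> c * (C * (1 + M) ^ N / (1 + \<bar>y\<bar>) ^ N)"
          using c by (intro mult_left_mono) auto
        then show ?thesis using c by (simp add: abs_mult)
      qed
    qed (use M(1)[of i] M(2) in auto)
    then have "\<bar>(\<Phi> (c * (X i - y)) - \<Phi> (c * (x - y))) / (X i - x)\<bar> \<le> c * (C * (1 + M) ^ N / (1 + \<bar>y\<bar>) ^ N)"
      using Xne[of i] by (simp add: pos_divide_le_eq)
    from mult_left_mono[OF this, of "\<bar>f y\<bar>"] show ?thesis by (simp add: abs_mult mult_ac)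
  qed
  have lim: "(\<lambda>i. ?q i y) \<longlonglongrightarrow> f y * (c * deriv \<Phi> (c * (x - y)))" for y
  proof (intro tendsto_mult tendsto_const)
    have "((\<lambda>z. (\<Phi> (c * (z - y)) - \<Phi> (c * (x - y))) / (z - x)) \<longlongrightarrow> c * deriv \<Phi> (c * (x - y))) (at x)"
      using der[of y x UNIV] by (simp add: has_field_derivative_iff)
    moreover have "filterlim X (at x) sequentially"
      using X Xne by (auto simp: filterlim_at)
    ultimately show "(\<lambda>i. (\<Phi> (c * (X i - y)) - \<Phi> (c * (x - y))) / (X i - x)) \<longlonglongrightarrow> c * deriv \<Phi> (c * (x - y))"
      by (rule filterlim_compose)
  qed
  have lim_int: "(\<lambda>i. LINT y|lborel. ?q i y) \<longlonglongrightarrow> (LINT y|lborel. f y * (c * deriv \<Phi> (c * (x - y))))"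
    by (rule integral_dominated_convergence[OF _ _ integrable_mult_right[OF weight, of "c * C * (1 + M) ^ N"]])
       (use bnd lim in auto)
  have eq: "(LINT y|lborel. ?q i y)
      = ((LINT y|lborel. f y * \<Phi> (c * (X i - y))) - (LINT y|lborel. f y * \<Phi> (c * (x - y)))) / (X i - x)" for i
    using integrable_against_schwartz[OF \<Phi> c]
    by (simp add: diff_divide_distrib right_diff_distrib)
  show "((\<lambda>z. ((LINT y|lborel. f y * \<Phi> (c * (z - y))) - (LINT y|lborel. f y * \<Phi> (c * (x - y)))) / (z - x)) \<circ> X)
      \<longlonglongrightarrow> (LINT y|lborel. f y * (c * deriv \<Phi> (c * (x - y))))"
    using lim_int unfolding o_def eq .
qed

end

lemma mollify_0 [simp]: "mollify f \<Phi> 0 = (\<lambda>_. 0)"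
  by (simp add: mollify_def[abs_def] rescale_def)

lemma mollify_smooth:
  assumes f: "continuous_on UNIV f" "mollifiable f" and \<Phi>: "mollifier \<Phi>"
  shows "(mollify f \<Phi> n has_real_derivative deriv (mollify f \<Phi> n) x) (at x)"
    and "continuous_on UNIV (deriv (mollify f \<Phi> n))"
proof -
  have "\<exists>g. (\<forall>x. (mollify f \<Phi> n has_real_derivative g x) (at x)) \<and> continuous_on UNIV g"
  proof (cases "n = 0")
    case True
    then show ?thesis by (auto intro!: exI[of _ "\<lambda>_. 0"])
  next
    case False
    then have c: "real n \<ge> 1" by simp
    have \<Phi>: "\<Phi> \<in> schwartz" using \<Phi> by (simp add: mollifier_def)
    obtain N where w: "integrable lborel (\<lambda>y. \<bar>f y\<bar> / (1 + \<bar>y\<bar>) ^ N)"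
      using mollifiable_weight[OF f] by metis
    \<comment> \<open>The factors \<open>n\<close> from the scaling and from the chain rule are put
      into the kernels. The derivative is then again a convolution with a Schwartz function, hence
      itself differentiable and so continuous.\<close>
    define \<Phi>1 where "\<Phi>1 = (\<lambda>z. real n * \<Phi> z)"
    define \<Phi>2 where "\<Phi>2 = (\<lambda>z. real n * deriv \<Phi>1 z)"
    have s1: "\<Phi>1 \<in> schwartz" unfolding \<Phi>1_def by (intro schwartz_cmult \<Phi>)
    have s2: "\<Phi>2 \<in> schwartz" unfolding \<Phi>2_def by (intro schwartz_cmult deriv_schwartz s1)
    have "mollify f \<Phi> n = (\<lambda>x. LINT y|lborel. f y * \<Phi>1 (real n * (x - y)))"
      by (simp add: mollify_def[abs_def] rescale_def \<Phi>1_def)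
    then have "(mollify f \<Phi> n has_real_derivative (LINT y|lborel. f y * \<Phi>2 (real n * (x - y)))) (at x)" for x
      using convolution_has_derivative[OF f(1) w s1 c] by (simp add: \<Phi>2_def)
    moreover have "continuous_on UNIV (\<lambda>x. LINT y|lborel. f y * \<Phi>2 (real n * (x - y)))"
      by (rule DERIV_continuous_on) (rule convolution_has_derivative[OF f(1) w s2 c])
    ultimately show ?thesis
      by (intro exI[of _ "\<lambda>x. LINT y|lborel. f y * \<Phi>2 (real n * (x - y))"]) simp
  qed
  then obtain g where g: "\<And>x. (mollify f \<Phi> n has_real_derivative g x) (at x)" "continuous_on UNIV g"
    by blast
  then have "deriv (mollify f \<Phi> n) = g" by (intro ext DERIV_imp_deriv)
  with g show "(mollify f \<Phi> n has_real_derivative deriv (mollify f \<Phi> n) x) (at x)"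
    "continuous_on UNIV (deriv (mollify f \<Phi> n))" by simp_all
qed

lemma integral_rescale:
  assumes "n > 0"
  shows "(LINT y|lborel. rescale \<Phi> n (x - y)) = (LINT y|lborel. \<Phi> y)"
  using lborel_integral_real_affine[of "- real n" \<Phi> "real n * x"] assms
  by (simp add: rescale_def algebra_simps)

lemma integrable_rescale:
  assumes "integrable lborel \<Phi>" "n > 0"
  shows "integrable lborel (\<lambda>y. rescale \<Phi> n (x - y))"
  using lborel_integrable_real_affine[OF assms(1), of "- real n" "real n * x"] assms(2)
  by (simp add: rescale_def algebra_simps)

text \<open>The approximate identity estimate for a signed kernel and a possibly unbounded
  \<open>f\<close>. Near \<open>x\<close> it uses uniform continuity of \<open>f\<close> and the
  integral \<open>J\<close> of the absolute value of \<Phi>; far from \<open>x\<close> the decay of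
  \<Phi> beats the growth of \<open>f\<close>, as measured by the weight.\<close>

lemma mollify_uniform_limit:
  assumes f: "continuous_on UNIV f" "mollifiable f" and \<Phi>: "mollifier \<Phi>" and K: "compact K"
  shows "uniform_limit K (mollify f \<Phi>) f sequentially"
proof (rule uniform_limitI)
  fix e :: real assume e: "e > 0"
  have S: "\<Phi> \<in> schwartz" and I1: "(LINT x|lborel. \<Phi> x) = 1" using \<Phi> by (auto simp: mollifier_def)
  obtain M where M: "\<And>x. x \<in> K \<Longrightarrow> \<bar>x\<bar> \<le> M" "M \<ge> 0"
    using compact_imp_bounded[OF K] by (auto simp: bounded_pos) (meson less_imp_le)
  obtain N where N: "N \<ge> 2" and w: "integrable lborel (\<lambda>y. \<bar>f y\<bar> / (1 + \<bar>y\<bar>) ^ N)"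
    using mollifiable_weight[OF f] by metis
  have "integrable lborel (\<lambda>y::real. \<bar>1\<bar> / (1 + \<bar>y\<bar>) ^ (N - 2 + 2))"
    by (rule integrable_weight[where C = 1]) (auto simp: set_lebesgue_integral_def)
  then have w1: "integrable lborel (\<lambda>y::real. 1 / (1 + \<bar>y\<bar>) ^ N)"
    using N by (simp only: abs_one le_add_diff_inverse2)
  have "bounded (f ` {-M..M})"
    using f(1) by (intro compact_imp_bounded compact_continuous_image) (auto intro: continuous_on_subset)
  then obtain FM where "FM > 0" and "\<forall>x\<in>{-M..M}. \<bar>f x\<bar> \<le> FM"
    by (auto simp: bounded_pos)
  then have FM: "\<bar>f x\<bar> \<le> FM" if "\<bar>x\<bar> \<le> M" for x
    using that by (auto simp: abs_le_iff)
  \<comment> \<open>\<open>W y\<close> dominates \<open>|f y - f x| / (1 + |y|) ^ N\<close> for all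
    \<open>|x| \<le> M\<close> at once.\<close>
  define W where "W y = (\<bar>f y\<bar> + FM) / (1 + \<bar>y\<bar>) ^ N" for y
  have W: "integrable lborel W"
    using Bochner_Integration.integrable_add[OF w integrable_mult_right[OF w1, of FM]]
    unfolding W_def by (simp add: add_divide_distrib)
  have W0: "W y \<ge> 0" for y using \<open>FM > 0\<close> by (simp add: W_def)
  obtain C where C: "C > 0" "\<And>z. \<bar>\<Phi> z\<bar> \<le> C / (1 + \<bar>z\<bar>) ^ N"
    using schwartz_decay[OF S] by metis
  define J where "J = (LINT y|lborel. \<bar>\<Phi> y\<bar>)"
  have J: "J \<ge> 0" by (simp add: J_def)
  define e1 where "e1 = e / (2 * (J + 1))"
  have e1: "e1 > 0" using e J by (simp add: e1_def)
  \<comment> \<open>The margin 1, together with \<open>d \<le> 1\<close> below, keeps points near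
    \<open>x\<close> inside the interval.\<close>
  have "uniformly_continuous_on {-M-1..M+1} f"
    using f(1) by (intro compact_uniformly_continuous) (auto intro: continuous_on_subset)
  then obtain d0 where d0: "d0 > 0"
    "\<And>x y. x \<in> {-M-1..M+1} \<Longrightarrow> y \<in> {-M-1..M+1} \<Longrightarrow> \<bar>y - x\<bar> < d0 \<Longrightarrow> \<bar>f y - f x\<bar> < e1"
    using e1 unfolding uniformly_continuous_on_def dist_real_def by metis
  define d where "d = min d0 1"
  have d: "d > 0" using d0 by (simp add: d_def)
  \<comment> \<open>For \<open>r \<ge> d\<close> one has \<open>1 + r \<le> (1 + d) / d * r\<close>,
    hence \<open>1 + |y| \<le> (1 + M) * (1 + d) / d * r\<close> with
    \<open>r = |x - y|\<close>.\<close>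
  define Q where "Q = C * ((1 + M) * (1 + d) / d) ^ N"
  have Q: "Q > 0" using C(1) d M(2) by (simp add: Q_def)
  have key: "\<bar>mollify f \<Phi> n x - f x\<bar> \<le> e1 * J + Q / n * (LINT y|lborel. W y)"
    if n: "n > 0" and x: "\<bar>x\<bar> \<le> M" for n :: nat and x
  proof -
    have ir: "integrable lborel (\<lambda>y. rescale \<Phi> n (x - y))"
      by (rule integrable_rescale[OF schwartz_integrable[OF S] n])
    have ia: "integrable lborel (\<lambda>y. \<bar>rescale \<Phi> n (x - y)\<bar>)" using ir by (rule integrable_abs)
    have "(LINT y|lborel. \<bar>rescale \<Phi> n (x - y)\<bar>) = (LINT y|lborel. rescale (\<lambda>z. \<bar>\<Phi> z\<bar>) n (x - y))"
      by (simp add: rescale_def abs_mult)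
    also have "\<dots> = J" using integral_rescale[OF n] by (simp add: J_def)
    finally have J': "(LINT y|lborel. \<bar>rescale \<Phi> n (x - y)\<bar>) = J" .
    have im: "integrable lborel (\<lambda>y. f y * rescale \<Phi> n (x - y))"
      using f(2)[unfolded mollifiable_def, rule_format, OF \<Phi> n] .
    have bnd: "\<bar>(f y - f x) * rescale \<Phi> n (x - y)\<bar> \<le> e1 * \<bar>rescale \<Phi> n (x - y)\<bar> + Q / n * W y" for y
    proof (cases "\<bar>y - x\<bar> < d")
      case True
      then have "\<bar>y - x\<bar> < d0" "\<bar>y - x\<bar> < 1" by (simp_all add: d_def)
      moreover from this have "x \<in> {-M-1..M+1}" "y \<in> {-M-1..M+1}"
        using x unfolding atLeastAtMost_iff by linarith+
      ultimately have "\<bar>f y - f x\<bar> < e1" using d0(2) by blast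
      then have "\<bar>f y - f x\<bar> * \<bar>rescale \<Phi> n (x - y)\<bar> \<le> e1 * \<bar>rescale \<Phi> n (x - y)\<bar>"
        by (intro mult_right_mono) auto
      then show ?thesis using Q W0[of y] by (simp add: abs_mult add_increasing2)
    next
      case False
      define r where "r = \<bar>x - y\<bar>"
      have r: "r \<ge> d" using False by (simp add: r_def)
      have "1 + \<bar>y\<bar> \<le> 1 + M + r" using x by (auto simp: r_def)
      also have "\<dots> \<le> (1 + M) * (1 + r)" using r d M(2) by (simp add: algebra_simps)
      also have "\<dots> \<le> (1 + M) * ((1 + d) / d * r)"
        using r d M(2) by (intro mult_left_mono) (simp_all add: field_simps)
      finally have "(1 + \<bar>y\<bar>) ^ N \<le> ((1 + M) * (1 + d) / d * r) ^ N"
        by (intro power_mono) auto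
      then have yr: "(1 + \<bar>y\<bar>) ^ N \<le> ((1 + M) * (1 + d) / d) ^ N * r ^ N"
        by (simp only: power_mult_distrib)
      \<comment> \<open>Since \<open>N \<ge> 2\<close>, the decay yields two powers of
        \<open>n\<close>: one cancels the prefactor of \<open>rescale\<close>, the other makes the
        far part vanish like \<open>1 / n\<close>.\<close>
      have "real n * real n * r ^ N \<le> real n ^ N * r ^ N"
        using power_increasing[OF N, of "real n"] n r d
        by (intro mult_right_mono) (auto simp: power2_eq_square)
      also have "\<dots> = \<bar>real n * (x - y)\<bar> ^ N" by (simp add: r_def abs_mult power_mult_distrib)
      also have "\<dots> \<le> (1 + \<bar>real n * (x - y)\<bar>) ^ N" by (intro power_mono) auto
      finally have nr: "real n * real n * r ^ N \<le> (1 + \<bar>real n * (x - y)\<bar>) ^ N" .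
      have "\<bar>rescale \<Phi> n (x - y)\<bar> = real n * \<bar>\<Phi> (real n * (x - y))\<bar>"
        by (simp add: rescale_def abs_mult)
      also have "\<dots> \<le> real n * (C / (1 + \<bar>real n * (x - y)\<bar>) ^ N)"
        by (intro mult_left_mono C) auto
      also have "\<dots> \<le> real n * (C / (real n * real n * r ^ N))"
        using nr C(1) n r d by (intro mult_left_mono divide_left_mono mult_pos_pos) auto
      also have "\<dots> = C / n * (1 / r ^ N)" using n by simp
      also have "\<dots> \<le> C / n * (((1 + M) * (1 + d) / d) ^ N / (1 + \<bar>y\<bar>) ^ N)"
        using yr C(1) n r d by (intro mult_left_mono) (simp_all add: divide_simps del: power_divide power_mult_distrib)
      also have "\<dots> = Q / n / (1 + \<bar>y\<bar>) ^ N" by (simp add: Q_def)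
      finally have *: "\<bar>rescale \<Phi> n (x - y)\<bar> \<le> Q / n / (1 + \<bar>y\<bar>) ^ N" .
      have "\<bar>f y - f x\<bar> * \<bar>rescale \<Phi> n (x - y)\<bar> \<le> (\<bar>f y\<bar> + FM) * (Q / n / (1 + \<bar>y\<bar>) ^ N)"
        using FM[OF x] \<open>FM > 0\<close> by (intro mult_mono *) auto
      also have "\<dots> = Q / n * W y" by (simp add: W_def)
      finally show ?thesis using e1 by (simp add: abs_mult add_increasing)
    qed
    \<comment> \<open>As the kernel has integral 1, \<open>f x\<close> can be moved under the
      integral.\<close>
    have "mollify f \<Phi> n x - f x = (LINT y|lborel. f y * rescale \<Phi> n (x - y)) - (LINT y|lborel. f x * rescale \<Phi> n (x - y))"
      by (simp add: mollify_def integral_rescale[OF n] I1)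
    also have "\<dots> = (LINT y|lborel. (f y - f x) * rescale \<Phi> n (x - y))"
      using im ir by (simp add: left_diff_distrib)
    finally have eq: "mollify f \<Phi> n x - f x = (LINT y|lborel. (f y - f x) * rescale \<Phi> n (x - y))" .
    have i2: "integrable lborel (\<lambda>y. e1 * \<bar>rescale \<Phi> n (x - y)\<bar> + Q / n * W y)"
      by (intro Bochner_Integration.integrable_add integrable_mult_right ia W)
    have "\<bar>mollify f \<Phi> n x - f x\<bar> \<le> (LINT y|lborel. e1 * \<bar>rescale \<Phi> n (x - y)\<bar> + Q / n * W y)"
      unfolding eq
      by (rule order_trans[OF integral_abs_bound]) (rule integral_mono'[OF i2 bnd], use e1 Q W0 in auto)
    also have "\<dots> = e1 * J + Q / n * (LINT y|lborel. W y)"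
      using ia W by (simp add: J')
    finally show ?thesis .
  qed
  have eJ: "e1 * J \<le> e / 2" using e J by (simp add: e1_def field_simps)
  have "(\<lambda>n. Q / real n * (LINT y|lborel. W y)) \<longlonglongrightarrow> 0"
    by (intro tendsto_mult_left_zero lim_const_over_n)
  then have "\<forall>\<^sub>F n in sequentially. Q / real n * (LINT y|lborel. W y) < e / 2"
    using e by (intro order_tendstoD(2)) auto
  then show "\<forall>\<^sub>F n in sequentially. \<forall>x\<in>K. dist (mollify f \<Phi> n x) (f x) < e"
    using eventually_gt_at_top[of 0]
  proof eventually_elim
    case (elim n)
    show ?case
    proof
      fix x assume "x \<in> K"
      from elim(1) key[OF elim(2) M(1)[OF this]] eJ show "dist (mollify f \<Phi> n x) (f x) < e"
        unfolding dist_real_def by linarith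
    qed
  qed
qed

subsection \<open>Primitives\<close>

text \<open>The integral is signed for negative \<open>x\<close>, and \<open>Sigma_n\<close> is
  twice such a primitive.\<close>

definition primitive :: "(real \<Rightarrow> real) \<Rightarrow> real \<Rightarrow> real" where
  "primitive g x = (LBINT y=0..x. g y)"

lemma primitive_0 [simp]: "primitive g 0 = 0"
  by (simp add: primitive_def zero_ereal_def)

lemma primitive_has_derivative:
  assumes "continuous_on UNIV g"
  shows "(primitive g has_real_derivative g x) (at x)"
proof -
  \<comment> \<open>\<open>x\<close> is interior to this interval, so the derivative within it is
    the two-sided one.\<close>
  let ?a = "min 0 x - 1" and ?b = "max 0 x + 1"
  have "((\<lambda>u. LBINT y=ereal 0..ereal u. g y) has_vector_derivative g x) (at x within {?a..?b})"
    using assms by (intro interval_integral_FTC2) (auto intro: continuous_on_subset)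
  moreover have "at x within {?a..?b} = at x"
    by (rule at_within_interior) (auto simp: min_def max_def)
  ultimately show ?thesis
    by (simp add: primitive_def[abs_def] zero_ereal_def has_real_derivative_iff_has_vector_derivative)
qed

lemma continuous_on_primitive:
  "continuous_on UNIV g \<Longrightarrow> continuous_on A (primitive g)"
  by (meson primitive_has_derivative DERIV_continuous_on DERIV_subset subset_UNIV)

lemma primitive_cong:
  assumes "\<And>y. min 0 x < y \<Longrightarrow> y < max 0 x \<Longrightarrow> f y = g y"
  shows "primitive f x = primitive g x"
  unfolding primitive_def
proof (rule interval_integral_cong)
  fix y assume "y \<in> einterval (min 0 (ereal x)) (max 0 (ereal x))"
  then show "f y = g y"
    using assms by (auto simp: einterval_def zero_ereal_def min_def max_def split: if_splits)
qed

text \<open>On \<open>{0..x}\<close> both \<open>P - (primitive g - primitive h)\<close> and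
  \<open>P + (primitive g - primitive h)\<close> are nondecreasing. Stating the bound through an
  antiderivative \<open>P\<close> lets exponential bounds enter without evaluating an
  integral.\<close>

lemma primitive_diff_le:
  assumes g: "continuous_on UNIV g" and h: "continuous_on UNIV h" and x: "0 \<le> x"
    and P: "\<And>t. (P has_real_derivative p t) (at t)"
    and le: "\<And>t. 0 \<le> t \<Longrightarrow> t \<le> x \<Longrightarrow> \<bar>g t - h t\<bar> \<le> p t"
  shows "\<bar>primitive g x - primitive h x\<bar> \<le> P x - P 0"
proof -
  have "P 0 - (primitive g 0 - primitive h 0) \<le> P x - (primitive g x - primitive h x)"
    by (rule DERIV_nonneg_imp_nondecreasing[OF x])
       (use le in \<open>auto intro!: exI derivative_eq_intros P primitive_has_derivative[OF g] primitive_has_derivative[OF h] simp: abs_le_iff\<close>)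
  moreover have "P 0 + (primitive g 0 - primitive h 0) \<le> P x + (primitive g x - primitive h x)"
    by (rule DERIV_nonneg_imp_nondecreasing[OF x])
       (use le in \<open>force intro!: exI derivative_eq_intros P primitive_has_derivative[OF g] primitive_has_derivative[OF h] simp: abs_le_iff\<close>)
  ultimately show ?thesis by simp
qed

lemma primitive_diff_le_const:
  assumes g: "continuous_on UNIV g" and h: "continuous_on UNIV h"
    and le: "\<And>t. \<bar>t\<bar> \<le> \<bar>x\<bar> \<Longrightarrow> \<bar>g t - h t\<bar> \<le> c"
  shows "\<bar>primitive g x - primitive h x\<bar> \<le> c * \<bar>x\<bar>"
proof -
  have "norm ((primitive g x - primitive h x) - (primitive g 0 - primitive h 0)) \<le> c * norm (x - 0)"
  proof (rule field_differentiable_bound)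
    show "convex {-\<bar>x\<bar>..\<bar>x\<bar>}" by simp
    show "((\<lambda>z. primitive g z - primitive h z) has_real_derivative g z - h z) (at z within {-\<bar>x\<bar>..\<bar>x\<bar>})" for z
      by (intro DERIV_diff DERIV_subset[OF primitive_has_derivative subset_UNIV] g h)
  qed (use le in auto)
  then show ?thesis by simp
qed

lemma uniform_limit_primitive:
  assumes g: "\<And>n. continuous_on UNIV (g n)" and h: "continuous_on UNIV h"
    and lim: "uniform_limit {-M..M} g h sequentially"
  shows "uniform_limit {-M..M} (\<lambda>n. primitive (g n)) (primitive h) sequentially"
proof (rule uniform_limitI)
  fix e :: real assume e: "e > 0"
  \<comment> \<open>\<open>M\<close> may be negative, when the interval is empty;
    \<open>|M| + 1\<close> is positive in all cases and strictly exceeds \<open>|x|\<close>.\<close>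
  define c where "c = e / (\<bar>M\<bar> + 1)"
  have "c > 0" using e by (simp add: c_def)
  from uniform_limitD[OF lim this]
  show "\<forall>\<^sub>F n in sequentially. \<forall>x\<in>{-M..M}. dist (primitive (g n) x) (primitive h x) < e"
  proof eventually_elim
    case (elim n)
    show ?case
    proof
      fix x assume x: "x \<in> {-M..M}"
      have "\<bar>primitive (g n) x - primitive h x\<bar> \<le> c * \<bar>x\<bar>"
      proof (rule primitive_diff_le_const[OF g h])
        fix t assume "\<bar>t\<bar> \<le> \<bar>x\<bar>"
        then have "t \<in> {-M..M}" using x by auto
        with elim show "\<bar>g n t - h t\<bar> \<le> c" by (force simp: dist_real_def)
      qed
      also have "\<dots> < c * (\<bar>M\<bar> + 1)" using x \<open>c > 0\<close> by (intro mult_strict_left_mono) auto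
      finally show "dist (primitive (g n) x) (primitive h x) < e" by (simp add: dist_real_def c_def)
    qed
  qed
qed

subsection \<open>Shooting\<close>

lemma integral_equation_shooting:
  fixes E q :: "real \<Rightarrow> real" and G :: "real \<Rightarrow> real \<Rightarrow> real \<Rightarrow> real"
  assumes E: "continuous_on UNIV E" "\<And>x. E x > 0" and q: "continuous_on UNIV q"
    and G: "continuous_on UNIV (\<lambda>(t, y, z). G t y z)"
    and bd: "\<And>t y z. \<bar>G t y z\<bar> \<le> B0"
    and lip: "\<And>t y z y' z'. \<bar>G t y z - G t y' z'\<bar> \<le> K * (\<bar>y - y'\<bar> + \<bar>z - z'\<bar>)"
  obtains C v where "continuous_on UNIV v"
    "\<And>x. x \<in> {0..1} \<Longrightarrow> v x = E x * (C + primitive (\<lambda>t. q t * G t (A + primitive v t) (v t)) x)"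
    "A + primitive v 1 = B"
proof -
  have cI: "continuous_on {0..1} E" "continuous_on {0..1} q"
    using E(1) q by (auto intro: continuous_on_subset)
  obtain Em where Em: "Em > 0" "\<And>x. x \<in> {0..1} \<Longrightarrow> E x \<le> Em"
    using compact_imp_bounded[OF compact_continuous_image[OF cI(1)]]
    by (auto simp: bounded_pos) (meson abs_le_D1 atLeastAtMost_iff)
  obtain Q where Q: "Q > 0" "\<And>x. x \<in> {0..1} \<Longrightarrow> \<bar>q x\<bar> \<le> Q"
    using compact_imp_bounded[OF compact_continuous_image[OF cI(2)]] by (auto simp: bounded_pos)
  \<comment> \<open>The positive minimum of \<open>E\<close> is what makes \<open>v\<close> large
    when \<open>C\<close> is large.\<close>
  obtain x0 where x0: "x0 \<in> {0..1}" "\<And>x. x \<in> {0..1} \<Longrightarrow> E x0 \<le> E x"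
    using continuous_attains_inf[OF _ _ cI(1)] by auto
  have B0: "B0 \<ge> 0" using order_trans[OF abs_ge_zero bd] .
  have K: "K \<ge> 0" using order_trans[OF abs_ge_zero lip[of 0 0 0 1 0]] by simp
  \<comment> \<open>The contraction factor will be \<open>2 * Em * Q * K / L\<close>, at most 1/2 by
    this choice; the summand 1 keeps \<open>L\<close> positive when \<open>K = 0\<close>.\<close>
  define L where "L = 4 * Em * Q * K + 1"
  have L: "L > 0" using Em(1) Q(1) K by (simp add: L_def add_nonneg_pos)
  \<comment> \<open>Composition with this clamping makes a continuous function on
    \<open>{0..1}\<close> a bounded continuous function on the line, an element of the complete
    space on which \<open>T\<close> acts.\<close>
  define cl where "cl x = max 0 (min 1 x)" for x :: real
  have cl: "cl x \<in> {0..1}" "x \<in> {0..1} \<Longrightarrow> cl x = x" for x by (auto simp: cl_def)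
  have cl_cont: "continuous_on UNIV cl" unfolding cl_def by (intro continuous_intros)
  \<comment> \<open>The fixed point problem is posed for \<open>w\<close>, with \<open>V w\<close>
    in the role of \<open>v\<close>. The plain supremum metric on \<open>w\<close> is then the
    weighted one on \<open>v\<close>, and \<open>R\<close> divides by the weight again.\<close>
  define V where "V w s = exp (L * s) * w s" for w s
  define H where "H w t = G t (A + primitive (V w) t) (V w t)" for w t
  define R where "R C w x = exp (- L * x) * (E x * (C + primitive (\<lambda>t. q t * H w t) x))" for C w x
  have V: "continuous_on UNIV (V w)" if "continuous_on UNIV w" for w
    unfolding V_def by (intro continuous_intros that)
  have H: "continuous_on UNIV (H w)" if "continuous_on UNIV w" for w
  proof -
    have "continuous_on UNIV (\<lambda>t. (t, A + primitive (V w) t, V w t))"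
      by (intro continuous_intros continuous_on_primitive V that)
    from continuous_on_compose2[OF G this] show ?thesis by (simp add: H_def[abs_def])
  qed
  have qH: "continuous_on UNIV (\<lambda>t. q t * H w t)" if "continuous_on UNIV w" for w
    by (intro continuous_intros q H that)
  have R: "continuous_on UNIV (R C w)" if "continuous_on UNIV w" for C w
    unfolding R_def by (intro continuous_intros E(1) continuous_on_primitive qH that)
  define T :: "real \<Rightarrow> (real \<Rightarrow>\<^sub>C real) \<Rightarrow> (real \<Rightarrow>\<^sub>C real)"
    where "T C w = Bcontfun (\<lambda>x. R C w (cl x))" for C w
  have T: "apply_bcontfun (T C w) x = R C w (cl x)" for C w x
  proof -
    have c: "continuous_on UNIV (\<lambda>x. R C w (cl x))"
      by (rule continuous_on_compose2[OF R cl_cont]) auto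
    have "bounded (R C w ` {0..1})"
      by (intro compact_imp_bounded compact_continuous_image continuous_on_subset[OF R]) auto
    then have "bounded (range (\<lambda>x. R C w (cl x)))"
      by (rule bounded_subset) (use cl in auto)
    with c show ?thesis
      unfolding T_def by (subst Bcontfun_inverse) (auto simp: bcontfun_def)
  qed
  have Vdiff: "\<bar>V w1 t - V w2 t\<bar> \<le> exp (L * t) * dist w1 w2" for w1 w2 :: "real \<Rightarrow>\<^sub>C real" and t
    using dist_bounded[of w1 t w2]
    by (simp add: V_def dist_real_def abs_mult flip: right_diff_distrib)
  have PVdiff: "\<bar>primitive (V w1) t - primitive (V w2) t\<bar> \<le> exp (L * t) * dist w1 w2"
    if t: "t \<in> {0..1}" for w1 w2 :: "real \<Rightarrow>\<^sub>C real" and t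
  proof -
    have "\<bar>primitive (V w1) t - primitive (V w2) t\<bar> \<le> exp (L * t) * dist w1 w2 * \<bar>t\<bar>"
    proof (rule primitive_diff_le_const[OF V V])
      fix s assume "\<bar>s\<bar> \<le> \<bar>t\<bar>"
      then have "exp (L * s) \<le> exp (L * t)" using L t by auto
      then show "\<bar>V w1 s - V w2 s\<bar> \<le> exp (L * t) * dist w1 w2"
        by (intro order_trans[OF Vdiff] mult_right_mono) auto
    qed auto
    also have "\<dots> \<le> exp (L * t) * dist w1 w2 * 1" using t by (intro mult_left_mono) auto
    finally show ?thesis by simp
  qed
  have Hdiff: "\<bar>H w1 t - H w2 t\<bar> \<le> 2 * K * dist w1 w2 * exp (L * t)"
    if t: "t \<in> {0..1}" for w1 w2 :: "real \<Rightarrow>\<^sub>C real" and t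
  proof -
    have "\<bar>H w1 t - H w2 t\<bar> \<le> K * (\<bar>(A + primitive (V w1) t) - (A + primitive (V w2) t)\<bar> + \<bar>V w1 t - V w2 t\<bar>)"
      unfolding H_def by (rule lip)
    also have "\<dots> \<le> K * (exp (L * t) * dist w1 w2 + exp (L * t) * dist w1 w2)"
      using PVdiff[OF t, of w1 w2] Vdiff[of w1 t w2] K by (intro mult_left_mono add_mono) auto
    finally show ?thesis by (simp add: algebra_simps)
  qed
  have Tdiff: "dist (T C w1) (T C w2) \<le> 1/2 * dist w1 w2" for C w1 w2
  proof (rule dist_bound)
    fix y
    define x where "x = cl y"
    have x: "x \<in> {0..1}" using cl by (simp add: x_def)
    define D where "D = 2 * K * Q * dist w1 w2"
    have D: "D \<ge> 0" using K Q(1) by (simp add: D_def)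
    \<comment> \<open>Here the factor \<open>1 / L\<close> is gained: an antiderivative of
      \<open>D * exp (L * t)\<close> is \<open>D / L * exp (L * t)\<close>, and the factor
      \<open>exp (- L * x)\<close> of \<open>R\<close> then cancels the exponential.\<close>
    have "\<bar>primitive (\<lambda>t. q t * H w1 t) x - primitive (\<lambda>t. q t * H w2 t) x\<bar>
        \<le> D / L * exp (L * x) - D / L * exp (L * 0)"
    proof (rule primitive_diff_le[where p = "\<lambda>t. D * exp (L * t)"])
      show "((\<lambda>a. D / L * exp (L * a)) has_real_derivative D * exp (L * t)) (at t)" for t
        using L by (auto intro!: derivative_eq_intros)
      fix t assume "0 \<le> t" "t \<le> x"
      then have t: "t \<in> {0..1}" using x by auto
      have "\<bar>q t\<bar> * \<bar>H w1 t - H w2 t\<bar> \<le> Q * (2 * K * dist w1 w2 * exp (L * t))"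
        using Q t Hdiff[OF t] by (intro mult_mono) auto
      then show "\<bar>q t * H w1 t - q t * H w2 t\<bar> \<le> D * exp (L * t)"
        by (simp add: D_def abs_mult mult_ac flip: right_diff_distrib)
    qed (use x qH in auto)
    also have "\<dots> \<le> D / L * exp (L * x)" using D L by simp
    finally have pd: "\<bar>primitive (\<lambda>t. q t * H w1 t) x - primitive (\<lambda>t. q t * H w2 t) x\<bar> \<le> D / L * exp (L * x)" .
    have "dist (T C w1 y) (T C w2 y)
        = exp (- L * x) * (E x * \<bar>primitive (\<lambda>t. q t * H w1 t) x - primitive (\<lambda>t. q t * H w2 t) x\<bar>)"
      unfolding T x_def[symmetric] R_def dist_real_def right_diff_distrib[symmetric] abs_mult
      using E(2)[of x] by simp
    also have "\<dots> \<le> exp (- L * x) * (Em * (D / L * exp (L * x)))"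
      using Em(2)[OF x] Em(1) pd by (intro mult_left_mono mult_mono) auto
    also have "\<dots> = Em * D / L" by (simp add: exp_minus)
    also have "\<dots> \<le> 1/2 * dist w1 w2"
    proof -
      have "2 * (Em * D) = (L - 1) * dist w1 w2" by (simp add: D_def L_def)
      also have "\<dots> \<le> L * dist w1 w2" by (intro mult_right_mono) auto
      finally show ?thesis using L by (simp add: field_simps)
    qed
    finally show "dist (T C w1 y) (T C w2 y) \<le> 1/2 * dist w1 w2" .
  qed
  have TC: "dist (T C w) (T C' w) \<le> Em * \<bar>C - C'\<bar>" for C C' w
  proof (rule dist_bound)
    fix y
    define x where "x = cl y"
    have x: "x \<in> {0..1}" using cl by (simp add: x_def)
    have "dist (T C w y) (T C' w y) = exp (- L * x) * E x * \<bar>C - C'\<bar>"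
      unfolding T x_def[symmetric] R_def dist_real_def right_diff_distrib[symmetric] abs_mult
      using E(2)[of x] by simp
    also have "\<dots> \<le> 1 * Em * \<bar>C - C'\<bar>"
      using Em x L E(2)[of x] by (intro mult_right_mono mult_mono) auto
    finally show "dist (T C w y) (T C' w y) \<le> Em * \<bar>C - C'\<bar>" by simp
  qed
  have "\<exists>w. T C w = w" for C
    using banach_fix_type[of "1/2" "T C"] Tdiff by auto
  then obtain W where W: "\<And>C. T C (W C) = W C" by metis
  define v where "v C = V (apply_bcontfun (W C))" for C
  have v_cont: "continuous_on UNIV (v C)" for C by (simp add: v_def V)
  have v_eq: "v C x = E x * (C + primitive (\<lambda>t. q t * G t (A + primitive (v C) t) (v C t)) x)"
    if "x \<in> {0..1}" for C x
  proof -
    have "v C x = exp (L * x) * T C (W C) x" by (simp add: v_def V_def W)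
    also have "\<dots> = exp (L * x) * R C (W C) x" using cl(2)[OF that] by (simp add: T)
    also have "\<dots> = E x * (C + primitive (\<lambda>t. q t * H (W C) t) x)"
      by (simp add: R_def exp_minus)
    finally show ?thesis by (simp add: H_def[abs_def] v_def)
  qed
  \<comment> \<open>The distance \<open>d\<close> of the two fixed points satisfies
    \<open>d \<le> d / 2 + Em * |C - C'|\<close>.\<close>
  have Wdiff: "dist (W C) (W C') \<le> 2 * Em * \<bar>C - C'\<bar>" for C C'
    using dist_triangle[of "T C (W C)" "T C' (W C')" "T C (W C')"] Tdiff[of C "W C" "W C'"] TC[of C "W C'" C']
    by (simp add: W)
  have cont: "continuous_on S (\<lambda>C. A + primitive (v C) 1)" for S
  proof (rule lipschitz_on_continuous_on)
    show "(exp L * (2 * Em))-lipschitz_on S (\<lambda>C. A + primitive (v C) 1)"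
    proof (rule lipschitz_onI)
      fix C C'
      have "dist (A + primitive (v C) 1) (A + primitive (v C') 1) \<le> exp L * dist (W C) (W C')"
        using PVdiff[of 1 "W C" "W C'"] by (simp add: v_def dist_real_def)
      also have "\<dots> \<le> exp L * (2 * Em * \<bar>C - C'\<bar>)" by (intro mult_left_mono Wdiff) auto
      finally show "dist (A + primitive (v C) 1) (A + primitive (v C') 1) \<le> exp L * (2 * Em) * dist C C'"
        by (simp add: dist_real_def)
    qed (use Em in auto)
  qed
  let ?p = "\<lambda>C x. primitive (\<lambda>t. q t * G t (A + primitive (v C) t) (v C t)) x"
  have p_bd: "\<bar>?p C x\<bar> \<le> Q * B0" if x: "x \<in> {0..1}" for C x
  proof -
    have cq: "continuous_on UNIV (\<lambda>t. q t * G t (A + primitive (v C) t) (v C t))"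
      using qH[of "W C"] by (simp add: H_def v_def)
    have "\<bar>?p C x - primitive (\<lambda>_. 0) x\<bar> \<le> Q * B0 * x - Q * B0 * 0"
    proof (rule primitive_diff_le[OF cq, where p = "\<lambda>_. Q * B0"])
      show "((*) (Q * B0) has_real_derivative Q * B0) (at t)" for t
        by (auto intro!: derivative_eq_intros)
      show "\<bar>q t * G t (A + primitive (v C) t) (v C t) - 0\<bar> \<le> Q * B0" if "0 \<le> t" "t \<le> x" for t
        using that x bd Q by (auto simp: abs_mult intro!: mult_mono)
    qed (use x in auto)
    moreover have "primitive (\<lambda>_. 0) x = 0" by (simp add: primitive_def)
    moreover have "Q * B0 * x \<le> Q * B0 * 1" using Q B0 x by (intro mult_left_mono) auto
    ultimately show ?thesis by simp
  qed
  \<comment> \<open>The integral term is at most \<open>Q * B0\<close> in absolute value, so with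
    this value \<open>v C1\<close> stays above \<open>|B - A|\<close> and \<open>v (- C1)\<close>
    below \<open>- |B - A|\<close>.\<close>
  define C1 where "C1 = Q * B0 + \<bar>B - A\<bar> / E x0"
  have C1: "E x0 * (C1 - Q * B0) = \<bar>B - A\<bar>" using E(2)[of x0] by (simp add: C1_def)
  have C1': "C1 - Q * B0 \<ge> 0" using E(2)[of x0] by (simp add: C1_def)
  have "\<bar>B - A\<bar> \<le> v C1 x" if "x \<in> {0..1}" for x
  proof -
    have "E x0 * (C1 - Q * B0) \<le> E x * (C1 + ?p C1 x)"
      using p_bd[OF that, of C1] x0(2)[OF that] C1' E(2)[of x] by (intro mult_mono) auto
    then show ?thesis using v_eq[OF that] C1 by simp
  qed
  moreover have "v (- C1) x \<le> - \<bar>B - A\<bar>" if "x \<in> {0..1}" for x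
  proof -
    have "E x0 * (C1 - Q * B0) \<le> E x * - (- C1 + ?p (- C1) x)"
      using p_bd[OF that, of "- C1"] x0(2)[OF that] C1' E(2)[of x] by (intro mult_mono) auto
    then show ?thesis using v_eq[OF that, of "- C1"] C1 unfolding mult_minus_right by linarith
  qed
  \<comment> \<open>As \<open>{0..1}\<close> has length 1, constant bounds on \<open>w\<close> pass
    unchanged to \<open>primitive w 1\<close>; hence the end values for \<open>- C1\<close> and
    \<open>C1\<close> enclose \<open>B\<close>.\<close>
  moreover have "a \<le> primitive w 1" if "continuous_on UNIV w" "\<And>x. x \<in> {0..1} \<Longrightarrow> a \<le> w x" for a w
    using DERIV_nonneg_imp_nondecreasing[of 0 1 "\<lambda>x. primitive w x - a * x"] that
    by (force intro!: derivative_eq_intros primitive_has_derivative)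
  moreover have "primitive w 1 \<le> a" if "continuous_on UNIV w" "\<And>x. x \<in> {0..1} \<Longrightarrow> w x \<le> a" for a w
    using DERIV_nonneg_imp_nondecreasing[of 0 1 "\<lambda>x. a * x - primitive w x"] that
    by (force intro!: derivative_eq_intros primitive_has_derivative)
  ultimately have "\<bar>B - A\<bar> \<le> primitive (v C1) 1" "primitive (v (- C1)) 1 \<le> - \<bar>B - A\<bar>"
    using v_cont by auto
  then have "\<exists>C\<ge>- C1. C \<le> C1 \<and> A + primitive (v C) 1 = B"
    using C1' mult_nonneg_nonneg[OF less_imp_le[OF Q(1)] B0] by (intro IVT' cont) auto
  then obtain C where "A + primitive (v C) 1 = B" by blast
  with that[OF v_cont v_eq] show ?thesis by blast
qed

subsection \<open>Solutions of the regularised equations\<close>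

lemma compact_subset_interval:
  fixes K :: "real set"
  assumes "compact K"
  obtains M where "K \<subseteq> {-M..M}"
proof -
  obtain M where "\<forall>x\<in>K. \<bar>x\<bar> \<le> M"
    using compact_imp_bounded[OF assms] by (auto simp: bounded_iff)
  then have "K \<subseteq> {-M..M}" by (auto simp: abs_le_iff)
  then show ?thesis by (rule that)
qed

lemma C_k_0_iff: "f \<in> C_k 0 \<longleftrightarrow> continuous_on UNIV f"
  by (simp add: C_k_def)

lemma C_k_1I:
  assumes "\<And>x. (f has_real_derivative f' x) (at x)" "continuous_on UNIV f'"
  shows "f \<in> C_k 1" "deriv f = f'"
proof -
  show d: "deriv f = f'" using assms(1) by (intro ext DERIV_imp_deriv)
  have "f differentiable at x" for x using assms(1) real_differentiable_def by blast
  with assms(2) d show "f \<in> C_k 1" by (simp add: C_k_def)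
qed

lemma C_k_2I:
  assumes "\<And>x. (f has_real_derivative f' x) (at x)" "\<And>x. (f' has_real_derivative f'' x) (at x)"
    and "continuous_on UNIV f''"
  shows "f \<in> C_k 2" "deriv f = f'" "deriv f' = f''"
proof -
  show d: "deriv f = f'" "deriv f' = f''" using assms by (auto intro!: ext DERIV_imp_deriv)
  have "f differentiable at x" "f' differentiable at x" for x
    using assms real_differentiable_def by blast+
  with assms(3) d show "f \<in> C_k 2"
    by (auto simp: C_k_def numeral_2_eq_2 less_Suc_eq)
qed

lemma tendsto_C_k_0I:
  assumes "\<And>M. uniform_limit {-M..M} f g sequentially"
  shows "tendsto_C_k 0 f g"
  unfolding tendsto_C_k_def
proof (intro allI impI)
  fix j :: nat and K :: "real set" assume "j \<le> 0" "compact K"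
  moreover obtain M where "K \<subseteq> {-M..M}" using \<open>compact K\<close> by (rule compact_subset_interval)
  ultimately show "uniform_limit K (\<lambda>n. (deriv ^^ j) (f n)) ((deriv ^^ j) g) sequentially"
    using uniform_limit_on_subset[OF assms] by simp
qed

lemma tendsto_C_k_1I:
  assumes "\<And>M. uniform_limit {-M..M} f g sequentially"
    and "\<And>M. uniform_limit {-M..M} (\<lambda>n. deriv (f n)) (deriv g) sequentially"
  shows "tendsto_C_k 1 f g"
  unfolding tendsto_C_k_def
proof (intro allI impI)
  fix j :: nat and K :: "real set" assume "j \<le> 1" "compact K"
  moreover obtain M where "K \<subseteq> {-M..M}" using \<open>compact K\<close> by (rule compact_subset_interval)
  moreover have "j = 0 \<or> j = 1" using \<open>j \<le> 1\<close> by auto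
  ultimately show "uniform_limit K (\<lambda>n. (deriv ^^ j) (f n)) ((deriv ^^ j) g) sequentially"
    using uniform_limit_on_subset[OF assms(1)] uniform_limit_on_subset[OF assms(2)] by auto
qed

section \<open>The solution formula and its limit\<close>

lemma uniform_limit_exp:
  fixes f :: "nat \<Rightarrow> real \<Rightarrow> real"
  assumes lim: "uniform_limit A f g sequentially" and bd: "bounded (g ` A)"
  shows "uniform_limit A (\<lambda>n x. exp (f n x)) (\<lambda>x. exp (g x)) sequentially"
proof -
  obtain c where c: "\<And>x. x \<in> A \<Longrightarrow> \<bar>g x\<bar> \<le> c" using bd by (auto simp: bounded_iff)
  show ?thesis
  \<comment> \<open>\<open>exp\<close> is uniformly continuous on bounded intervals only; eventually
    \<open>f n\<close> is within 1 of \<open>g\<close> and so takes values in this one.\<close>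
  proof (rule uniform_limit_compose_uniformly_continuous_on[OF lim, of "{-(c+1)..c+1}"])
    show "uniformly_continuous_on {-(c+1)..c+1} (exp :: real \<Rightarrow> real)"
      by (intro compact_uniformly_continuous continuous_intros) auto
    show "\<forall>\<^sub>F n in sequentially. \<forall>x\<in>A. f n x \<in> {-(c+1)..c+1}"
      using uniform_limitD[OF lim zero_less_one]
    proof eventually_elim
      case (elim n)
      show ?case
      proof
        fix x assume "x \<in> A"
        with elim have "\<bar>f n x - g x\<bar> < 1" by (simp add: dist_real_def)
        with c[OF \<open>x \<in> A\<close>] show "f n x \<in> {-(c+1)..c+1}" unfolding atLeastAtMost_iff by linarith
      qed
    qed
  qed simp
qed

text \<open>The derivative of a solution of \<open>s/2 g'' + b g' = l\<close>, where \<open>S' = 2 b / s\<close>; it does not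
  involve \<open>b\<close>, hence it makes sense in the limit.\<close>

definition flux :: "(real \<Rightarrow> real) \<Rightarrow> (real \<Rightarrow> real) \<Rightarrow> (real \<Rightarrow> real) \<Rightarrow> real \<Rightarrow> real \<Rightarrow> real" where
  "flux S s l C x = exp (- S x) * (C + primitive (\<lambda>t. 2 * l t * exp (S t) / s t) x)"

lemma continuous_on_flux:
  assumes "continuous_on UNIV S" "continuous_on UNIV s" "\<And>x. s x > 0" "continuous_on UNIV l"
  shows "continuous_on UNIV (flux S s l C)"
  unfolding flux_def[abs_def] using assms less_imp_neq[OF assms(3)]
  by (intro continuous_intros continuous_on_primitive) (auto simp: less_le)

text \<open>In the product rule the exponentials cancel and leave
  \<open>- S' * flux + 2 * l / s\<close>, which is the equation \<open>s/2 g' + b g = l\<close>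
  solved for \<open>g'\<close>.\<close>

lemma flux_has_derivative:
  assumes S: "\<And>x. (S has_real_derivative 2 * b x / s x) (at x)" and s: "continuous_on UNIV s" "\<And>x. s x > 0"
    and l: "continuous_on UNIV l"
  shows "(flux S s l C has_real_derivative (2 * l x - 2 * b x * flux S s l C x) / s x) (at x)"
proof -
  have Sc: "continuous_on UNIV S" by (rule DERIV_continuous_on) (rule S)
  have "continuous_on UNIV (\<lambda>t. 2 * l t * exp (S t) / s t)"
    using s(2) by (intro continuous_intros Sc s(1) l) (auto simp: less_le)
  note P = primitive_has_derivative[OF this]
  show ?thesis
    unfolding flux_def[abs_def]
    by (rule derivative_eq_intros S P refl)+ (use s(2)[of x] in \<open>simp add: exp_minus field_simps\<close>)
qed

lemma uniform_limit_flux: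
  fixes S s :: "nat \<Rightarrow> real \<Rightarrow> real"
  assumes S: "\<And>n. continuous_on UNIV (S n)" "continuous_on UNIV S0"
    and s: "\<And>n. continuous_on UNIV (s n)" "continuous_on UNIV s0" "\<And>n x. s n x > 0" "\<And>x. s0 x > 0"
    and l: "continuous_on UNIV l"
    and limS: "uniform_limit {-M..M} S S0 sequentially" and lims: "uniform_limit {-M..M} s s0 sequentially"
  shows "uniform_limit {-M..M} (\<lambda>n. flux (S n) (s n) l C) (flux S0 s0 l C) sequentially"
proof -
  have bd: "bounded (f ` {-M..M})" if "continuous_on UNIV f" for f :: "real \<Rightarrow> real"
    using that by (intro compact_imp_bounded compact_continuous_image) (auto intro: continuous_on_subset)
  have g: "continuous_on UNIV (\<lambda>t. 2 * l t * exp (S t) / s t)"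
    if "continuous_on UNIV S" "continuous_on UNIV s" "\<And>x. s x > 0" for S s :: "real \<Rightarrow> real"
    using that by (intro continuous_intros l) (auto simp: less_le)
  \<comment> \<open>Convergence of the quotients needs \<open>s0\<close> bounded away from 0; for
    negative \<open>M\<close> the interval is empty and \<open>b = 1\<close> is taken.\<close>
  have "\<exists>b>0. \<forall>x\<in>{-M..M}. b \<le> s0 x"
  proof (cases "{-M..M} = {}")
    case False
    then show ?thesis
      using continuous_attains_inf[of "{-M..M}" s0] s(2,4) by (auto intro: continuous_on_subset)
  qed (auto intro: exI[of _ 1])
  then obtain b where b: "b > 0" "\<And>x. x \<in> {-M..M} \<Longrightarrow> b \<le> s0 x" by blast
  have "uniform_limit {-M..M} (\<lambda>n t. 2 * l t * exp (S n t)) (\<lambda>t. 2 * l t * exp (S0 t)) sequentially"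
    by (intro uniform_lim_mult uniform_limit_const uniform_limit_exp limS bd continuous_intros l S)
  then have "uniform_limit {-M..M} (\<lambda>n t. 2 * l t * exp (S n t) / s n t) (\<lambda>t. 2 * l t * exp (S0 t) / s0 t) sequentially"
    by (rule uniform_lim_divide[OF _ lims _ _ b(1)])
       (use b s(4) in \<open>auto simp: less_imp_le intro!: bd continuous_intros l S\<close>)
  then have P: "uniform_limit {-M..M} (\<lambda>n. primitive (\<lambda>t. 2 * l t * exp (S n t) / s n t))
      (primitive (\<lambda>t. 2 * l t * exp (S0 t) / s0 t)) sequentially"
    by (intro uniform_limit_primitive g S s)
  have "uniform_limit {-M..M} (\<lambda>n x. exp (- S n x)) (\<lambda>x. exp (- S0 x)) sequentially"
    by (intro uniform_limit_exp uniform_limit_uminus limS bd continuous_intros S)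
  then show ?thesis
    unfolding flux_def[abs_def]
    by (intro uniform_lim_mult uniform_limit_add uniform_limit_const P bd continuous_intros continuous_on_primitive g S s)
qed

text \<open>The approximations \<open>fs n\<close> come from the same formula with regularised
  coefficients, and \<open>L_n\<close> applied to \<open>fs n\<close> is itself taken as the
  right-hand side. So the equation holds for every \<open>n\<close>, although this right-hand side
  equals \<open>l\<close> merely on each compact set for large \<open>n\<close>; that suffices for
  convergence in \<open>C^0\<close>.\<close>

lemma C1_solution_flux:
  assumes \<sigma>: "continuous_on UNIV \<sigma>" "\<And>x. \<sigma> x > 0" and \<beta>: "continuous_on UNIV \<beta>"
    and mol: "mollifiable (\<lambda>x. (\<sigma> x)\<^sup>2)" "mollifiable \<beta>"
    and S: "continuous_on UNIV S" "\<And>\<Phi>. mollifier \<Phi> \<Longrightarrow> tendsto_C_k 0 (Sigma_n \<sigma> \<beta> \<Phi>) S"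
    and l: "continuous_on UNIV l"
  shows "C1_solution \<sigma> \<beta> l (\<lambda>x. A + primitive (flux S (\<lambda>t. (\<sigma> t)\<^sup>2) l C) x)"
proof -
  let ?s = "\<lambda>t. (\<sigma> t)\<^sup>2"
  define f where "f x = A + primitive (flux S ?s l C) x" for x
  have s: "continuous_on UNIV ?s" "\<And>x. ?s x > 0" using \<sigma> by (auto intro: continuous_intros simp: less_imp_neq[symmetric])
  have f0: "continuous_on UNIV (flux S ?s l C)" by (intro continuous_on_flux S s l)
  have f': "(f has_real_derivative flux S ?s l C x) (at x)" for x
    unfolding f_def by (auto intro!: derivative_eq_intros primitive_has_derivative[OF f0])
  note f1 = C_k_1I[OF f' f0]
  have "\<exists>fs ls. (\<forall>n. fs n \<in> C_k 2) \<and> (\<forall>n. ls n \<in> C_k 0) \<and>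
      (\<forall>n>0. L_n \<sigma> \<beta> \<Phi> n (fs n) = ls n) \<and> tendsto_C_k 1 fs f \<and> tendsto_C_k 0 ls l" if \<Phi>: "mollifier \<Phi>" for \<Phi>
  proof -
    let ?m = "mollify ?s \<Phi>" and ?b = "\<lambda>n. deriv (mollify \<beta> \<Phi> n)"
    have m: "continuous_on UNIV (?m n)" for n
      by (rule DERIV_continuous_on) (rule mollify_smooth(1)[OF s(1) mol(1) \<Phi>])
    have b: "continuous_on UNIV (?b n)" for n by (rule mollify_smooth(2)[OF \<beta> mol(2) \<Phi>])
    \<comment> \<open>positive everywhere, and equal to the mollified coefficient on any given compact set for large \<open>n\<close>\<close>
    define sn where "sn n x = max (?m n x) (?s x / 2)" for n x
    have sn: "continuous_on UNIV (sn n)" "sn n x > 0" for n x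
      using s(2)[of x] unfolding sn_def by (auto intro!: continuous_intros m s(1) simp: less_max_iff_disj)
    define Sn where "Sn n x = 2 * primitive (\<lambda>t. ?b n t / sn n t) x" for n x
    have "continuous_on UNIV (\<lambda>t. ?b n t / sn n t)" for n
      using sn(2) by (intro continuous_intros b sn(1)) (auto simp: less_le)
    from primitive_has_derivative[OF this]
    have Sn: "(Sn n has_real_derivative 2 * ?b n x / sn n x) (at x)" for n x
      unfolding Sn_def by (auto intro!: derivative_eq_intros)
    have Snc: "continuous_on UNIV (Sn n)" for n by (rule DERIV_continuous_on) (rule Sn)
    define g where "g n = flux (Sn n) (sn n) l C" for n
    define fs where "fs n x = A + primitive (g n) x" for n x
    have gc: "continuous_on UNIV (g n)" for n unfolding g_def by (intro continuous_on_flux Snc sn l)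
    have fs': "(fs n has_real_derivative g n x) (at x)" for n x
      unfolding fs_def by (auto intro!: derivative_eq_intros primitive_has_derivative[OF gc])
    have g': "(g n has_real_derivative (2 * l x - 2 * ?b n x * g n x) / sn n x) (at x)" for n x
      unfolding g_def by (intro flux_has_derivative Sn sn l)
    have g'c: "continuous_on UNIV (\<lambda>x. (2 * l x - 2 * ?b n x * g n x) / sn n x)" for n
      using sn(2) by (intro continuous_intros b gc sn(1) l) (auto simp: less_le)
    note fs2 = C_k_2I[OF fs' g' g'c]
    have L: "L_n \<sigma> \<beta> \<Phi> n (fs n) x = ?m n x / 2 * ((2 * l x - 2 * ?b n x * g n x) / sn n x) + ?b n x * g n x" for n x
      by (simp only: L_n_def fs2)
    have "continuous_on UNIV (L_n \<sigma> \<beta> \<Phi> n (fs n))" for n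
      unfolding L[abs_def] by (intro continuous_intros g'c m b gc) simp
    \<comment> \<open>Eventually \<open>?m n\<close> differs from \<open>?s\<close> by less than
      half the minimum of \<open>?s\<close> on the interval, so it is at least \<open>?s / 2\<close>
      there and wins the maximum.\<close>
    moreover have ev: "\<forall>\<^sub>F n in sequentially. \<forall>x\<in>{-M..M}. sn n x = ?m n x" for M
    proof (cases "{-M..M} = {}")
      case False
      obtain x0 where x0: "x0 \<in> {-M..M}" "\<And>x. x \<in> {-M..M} \<Longrightarrow> ?s x0 \<le> ?s x"
        using continuous_attains_inf[OF _ False continuous_on_subset[OF s(1)]] by auto
      have "?s x0 / 2 > 0" using s(2)[of x0] by simp
      from uniform_limitD[OF mollify_uniform_limit[OF s(1) mol(1) \<Phi> compact_Icc] this, of "-M" M]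
      show ?thesis
      proof eventually_elim
        case (elim n)
        show ?case
        proof
          fix x assume x: "x \<in> {-M..M}"
          with elim have "\<bar>?m n x - ?s x\<bar> < ?s x0 / 2" by (simp add: dist_real_def)
          with x0(2)[OF x] have "?s x / 2 \<le> ?m n x" by linarith
          then show "sn n x = ?m n x" by (simp add: sn_def)
        qed
      qed
    qed simp
    have lims: "uniform_limit {-M..M} sn ?s sequentially" for M
      using uniform_limit_cong[OF ev[of M], of ?s ?s] mollify_uniform_limit[OF s(1) mol(1) \<Phi> compact_Icc] by simp
    \<comment> \<open>The integrals run between 0 and \<open>x\<close>, inside
      \<open>{-M..M}\<close>, where the two denominators eventually agree; the assumed convergence
      of \<open>Sigma_n\<close> thus carries over to \<open>Sn\<close>.\<close>
    have "\<forall>\<^sub>F n in sequentially. \<forall>x\<in>{-M..M}. Sn n x = Sigma_n \<sigma> \<beta> \<Phi> n x" for M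
      using ev[of M]
    proof eventually_elim
      case (elim n)
      show ?case
      proof
        fix x assume x: "x \<in> {-M..M}"
        have "primitive (\<lambda>t. ?b n t / sn n t) x = primitive (\<lambda>t. ?b n t / ?m n t) x"
        proof (rule primitive_cong)
          fix y assume "min 0 x < y" "y < max 0 x"
          with x have "y \<in> {-M..M}" by (auto simp: min_def max_def split: if_splits)
          with elim show "?b n y / sn n y = ?b n y / ?m n y" by simp
        qed
        then show "Sn n x = Sigma_n \<sigma> \<beta> \<Phi> n x" by (simp add: Sn_def Sigma_n_def primitive_def)
      qed
    qed
    from uniform_limit_cong[OF this] S(2)[OF \<Phi>] have limS: "uniform_limit {-M..M} Sn S sequentially" for M
      by (simp add: tendsto_C_k_def)
    have limg: "uniform_limit {-M..M} g (flux S ?s l C) sequentially" for M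
      unfolding g_def by (intro uniform_limit_flux Snc S(1) sn s l limS lims)
    have limf: "uniform_limit {-M..M} fs f sequentially" for M
      unfolding fs_def[abs_def] f_def[abs_def]
      by (intro uniform_limit_add uniform_limit_const uniform_limit_primitive gc f0 limg)
    have "tendsto_C_k 1 fs f"
      using limf limg by (intro tendsto_C_k_1I) (simp_all only: fs2 f1)
    moreover have "tendsto_C_k 0 (\<lambda>n. L_n \<sigma> \<beta> \<Phi> n (fs n)) l"
    proof (rule tendsto_C_k_0I)
      fix M
      have "\<forall>\<^sub>F n in sequentially. \<forall>x\<in>{-M..M}. L_n \<sigma> \<beta> \<Phi> n (fs n) x = l x"
        using ev[of M]
      proof eventually_elim
        case (elim n)
        show ?case
        proof
          fix x assume "x \<in> {-M..M}"
          with elim have "?m n x = sn n x" by simp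
          then show "L_n \<sigma> \<beta> \<Phi> n (fs n) x = l x" using sn(2)[where n = n and x = x] by (simp add: L field_simps)
        qed
      qed
      from uniform_limit_cong[OF this, of l l] uniform_limit_const
      show "uniform_limit {-M..M} (\<lambda>n. L_n \<sigma> \<beta> \<Phi> n (fs n)) l sequentially" by blast
    qed
    ultimately show ?thesis using fs2(1)
      by (intro exI[of _ fs] exI[of _ "\<lambda>n. L_n \<sigma> \<beta> \<Phi> n (fs n)"]) (simp add: C_k_0_iff)
  qed
  moreover have "f \<in> C_k 1" by (rule f1)
  ultimately show ?thesis using l by (simp add: C1_solution_def C_k_0_iff f_def[abs_def])
qed

section \<open>The nonlinear boundary value problem\<close>

theorem proposition3p12:
  fixes \<sigma> \<beta> :: "real \<Rightarrow> real" and F :: "real \<Rightarrow> real \<Rightarrow> real \<Rightarrow> real" and A B :: real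
  assumes "continuous_on UNIV \<sigma>" and "\<And>x. \<sigma> x > 0"
    and "continuous_on UNIV \<beta>"
    and "mollifiable (\<lambda>x. (\<sigma> x)\<^sup>2)" and "mollifiable \<beta>"
    and "has_Sigma \<sigma> \<beta>"
    and "continuous_on ({0..1} \<times> UNIV) (\<lambda>(x, y, z). F x y z)"
    and "bounded ((\<lambda>(x, y, z). F x y z) ` ({0..1} \<times> UNIV))"
    and "\<exists>K. \<forall>x\<in>{0..1}. K-lipschitz_on UNIV (\<lambda>(y, z). F x y z)"
  shows "\<exists>u. bvp_solution \<sigma> \<beta> 0 1 F A B u"
proof -
  obtain S where S: "continuous_on UNIV S" "\<And>\<Phi>. mollifier \<Phi> \<Longrightarrow> tendsto_C_k 0 (Sigma_n \<sigma> \<beta> \<Phi>) S"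
    using assms(6) by (auto simp: has_Sigma_def C_k_0_iff)
  let ?s = "\<lambda>t. (\<sigma> t)\<^sup>2"
  have s: "continuous_on UNIV ?s" "\<And>x. ?s x > 0"
    using assms(1,2) by (auto intro: continuous_intros simp: less_imp_neq[symmetric])
  \<comment> \<open>Freezing the first argument of \<open>F\<close> at the nearer end point extends
    \<open>F\<close> to the whole line with the same bound and Lipschitz constant.\<close>
  define cl where "cl x = max 0 (min 1 x)" for x :: real
  have cl: "cl x \<in> {0..1}" "x \<in> {0..1} \<Longrightarrow> cl x = x" for x by (auto simp: cl_def)
  define G where "G t y z = F (cl t) y z" for t y z
  have G_cont: "continuous_on UNIV (\<lambda>(t, y, z). G t y z)"
  proof -
    have "continuous_on UNIV (\<lambda>p::real \<times> real \<times> real. (cl (fst p), snd p))"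
      unfolding cl_def by (intro continuous_intros)
    from continuous_on_compose2[OF assms(7) this] have
      "continuous_on UNIV (\<lambda>p::real \<times> real \<times> real. case (cl (fst p), snd p) of (x, y, z) \<Rightarrow> F x y z)"
      using cl(1) by blast
    then show ?thesis by (simp add: G_def case_prod_beta)
  qed
  obtain B0 where "\<forall>x\<in>{0..1}. \<forall>y z. \<bar>F x y z\<bar> \<le> B0"
    using assms(8) by (auto simp: bounded_iff)
  then have G_bd: "\<bar>G t y z\<bar> \<le> B0" for t y z using cl(1) by (simp add: G_def)
  obtain K where K: "\<And>x. x \<in> {0..1} \<Longrightarrow> K-lipschitz_on UNIV (\<lambda>(y, z). F x y z)"
    using assms(9) by blast
  \<comment> \<open>The Lipschitz condition refers to the Euclidean metric on pairs, which is at
    most the sum of the coordinate distances.\<close>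
  have G_lip: "\<bar>G t y z - G t y' z'\<bar> \<le> K * (\<bar>y - y'\<bar> + \<bar>z - z'\<bar>)" for t y z y' z'
  proof -
    have "\<bar>G t y z - G t y' z'\<bar> \<le> K * dist (y, z) (y', z')"
      using lipschitz_onD[OF K[OF cl(1)], of "(y, z)" "(y', z')" t] by (simp add: G_def dist_real_def)
    also have "\<dots> \<le> K * (\<bar>y - y'\<bar> + \<bar>z - z'\<bar>)"
      using lipschitz_on_nonneg[OF K[OF cl(1)]] sqrt_sum_squares_le_sum_abs[of "y - y'" "z - z'"]
      by (intro mult_left_mono) (auto simp: dist_Pair_Pair dist_real_def)
    finally show ?thesis .
  qed
  \<comment> \<open>With this \<open>E\<close> and the \<open>q\<close> below, the right-hand side
    of the integral equation is the \<open>flux\<close> for the \<open>l\<close> defined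
    afterwards.\<close>
  have E: "continuous_on UNIV (\<lambda>x. exp (- S x))" by (intro continuous_intros S(1))
  have q: "continuous_on UNIV (\<lambda>t. 2 * exp (S t) / ?s t)"
    using s(2) by (intro continuous_intros S(1) s(1)) (auto simp: less_le)
  obtain C v where v: "continuous_on UNIV v"
    and v_eq: "\<And>x. x \<in> {0..1} \<Longrightarrow> v x = exp (- S x) * (C + primitive (\<lambda>t. 2 * exp (S t) / ?s t * G t (A + primitive v t) (v t)) x)"
    and vB: "A + primitive v 1 = B"
    by (rule integral_equation_shooting[OF E exp_gt_zero q G_cont G_bd G_lip, of A B]) (rule that)
  define l where "l t = G t (A + primitive v t) (v t)" for t
  have l: "continuous_on UNIV l"
  proof -
    have "continuous_on UNIV (\<lambda>t. (t, A + primitive v t, v t))"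
      by (intro continuous_intros continuous_on_primitive v)
    from continuous_on_compose2[OF G_cont this] show ?thesis by (simp add: l_def[abs_def])
  qed
  \<comment> \<open>\<open>v\<close> satisfies the equation on \<open>{0..1}\<close> only. As
    \<open>l\<close> is already fixed on the whole line through \<open>v\<close>, the formula
    continues \<open>v\<close> to a flux \<open>w\<close> without solving an equation again.\<close>
  define w where "w = flux S ?s l C"
  have w: "continuous_on UNIV w" unfolding w_def by (intro continuous_on_flux S s l)
  have wv: "w x = v x" if "x \<in> {0..1}" for x
    unfolding v_eq[OF that] w_def flux_def l_def by (simp add: mult_ac)
  have pwv: "primitive w x = primitive v x" if "x \<in> {0..1}" for x
    using that by (intro primitive_cong wv) auto
  define u where "u x = A + primitive w x" for x
  \<comment> \<open>An arbitrary set \<open>T\<close> covers both the one-sided derivatives on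
    \<open>{0..1}\<close> and the derivative on the line.\<close>
  have u': "(u has_real_derivative w x) (at x within T)" for x T
    unfolding u_def
    by (auto intro!: derivative_eq_intros DERIV_subset[OF primitive_has_derivative[OF w] subset_UNIV])
  have sol: "C1_solution \<sigma> \<beta> l u"
    unfolding u_def[abs_def] w_def by (intro C1_solution_flux assms S l)
  have vd: "vector_derivative u (at x within {0..1}) = w x" if "x \<in> {0..1}" for x
    using u' that
    by (intro vector_derivative_within_cbox[of 0 1, simplified]) (simp_all add: has_real_derivative_iff_has_vector_derivative[symmetric])
  have "C1_on_interval 0 1 u"
    unfolding C1_on_interval_def
  proof
    show "u differentiable_on {0..1}"
      unfolding differentiable_on_def real_differentiable_def using u' by blast
    show "continuous_on {0..1} (\<lambda>x. vector_derivative u (at x within {0..1}))"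
      by (rule continuous_on_eq[OF continuous_on_subset[OF w subset_UNIV]]) (simp add: vd)
  qed
  moreover have "linear_bvp_solution \<sigma> \<beta> 0 1 (\<lambda>x. F x (u x) (vector_derivative u (at x within {0..1}))) A B u"
    unfolding linear_bvp_solution_def
  proof (intro exI conjI)
    \<comment> \<open>On \<open>{0..1}\<close> the clamping is the identity, \<open>v\<close> is the
      derivative of \<open>u\<close>, and the primitives of \<open>v\<close> and \<open>w\<close>
      agree.\<close>
    show "\<forall>x\<in>{0..1}. l x = F x (u x) (vector_derivative u (at x within {0..1}))"
      using vd wv pwv cl(2) by (simp add: l_def G_def u_def)
    show "u \<in> C_k 1" using u' w by (rule C_k_1I(1))
    show "u 1 = B" using vB pwv[of 1] by (simp add: u_def)
  qed (use l sol in \<open>simp_all add: C_k_0_iff u_def\<close>)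
  ultimately show ?thesis unfolding bvp_solution_def by blast
qed

end
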